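(* For every integer $n\ge 1$, the insertion procedure (defined in the context), which to a triple $(T,e,(x,y))$ associates a labeled tree-like tableau $T'$, induces a bijection between - the set of triples $(T,e,(x,y))$ where $T$ is a labeled tree-like tableau of size $n$, $e$ is a border edge of $T$, and $(x,y)$ is a bi-label compatible with $e$; and - the set of labeled tree-like tableaux of size $n+1$.
   Context: **Ferrers diagrams and border edges.** English convention: rows left-justified, longest row on top. The border edges of a Ferrers diagram $D$ are the edges at the end of rows (vertical border edges, one per row, at the right end) or of columns (horizontal border edges, one per column, at the bottom). Their number is the half-perimeter of $D$. For a box $c$ of $D$, $L_D(c)$ is the set of boxes in the same column as $c$ and above it, and $A_D(c)$ is the set of boxes in the same row as $c$ and to its left; same notation for a tableau $T$ of shape $D$. **Labeled tree-like tableaux.** A labeled tree-like tableau (LTLT) $T$ of size $n$ is a Ferrers diagram of half-perimeter $n+1$ in which some boxes (at most one label per box) and all border edges are labeled with $1,\alpha,\beta,\gamma$ or $\delta$, such that: - the Northwestern-most box (root box) is labeled by $1$; - the labels in the first row and the first column are the only labels $1$ (this includes the vertical border edge at the end of the first row and the horizontal border edge at the bottom of the first column; no other border edge is considered to lie in the first row or first column); - every vertical border edge not in the first row is labeled $\alpha$ or $\gamma$, and every horizontal border edge not in the first column is labeled $\beta$ or $\delta$; - in each row and each column there is at least one labeled box; - for each box $c$ labeled by $\alpha$ or $\gamma$, all boxes in $L_T(c)$ are empty and at least one box in $A_T(c)$ is labeled; - for each box $c$ labeled by $\beta$ or $\delta$, all boxes in $A_T(c)$ are empty and at least one box in $L_T(c)$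 is labeled. **Compatible bi-label.** Given an LTLT $T$ and a border edge $e$, a compatible bi-label is a couple $(x,y)$ of labels such that: if $e$ is in the first row (thus vertical), $x=1$ and $y\in\{\beta,\delta\}$; if $e$ is in the first column (thus horizontal), $y=1$ and $x\in\{\alpha,\gamma\}$; otherwise $x\in\{\alpha,\gamma\}$ and $y\in\{\beta,\delta\}$. **Column and row addition.** Let $e$ be a vertical border edge at the end of row $r$, with label $\ell$. The column addition at $e$ with new bi-label $(x,y)$ inserts a new column immediately to the right of the last box of row $r$, having one box in row $r$ and in each row above it (everything to the right, boxes and border edges, is shifted one unit to the right together with its labels). The new box in row $r$ is labeled $\ell$, the other new boxes are empty, and the two new border edges of that new box get labels: vertical one $x$, horizontal one $y$. If $e$ is a horizontal border edge at the bottom of column $c$, with label $\ell$, row addition is defined symmetrically: a new row is inserted immediately below the last box of column $c$, having one box in column $c$ and in each column to its left; the new box in column $c$ is labeled $\ell$, the other new boxes are empty, and the two new border edges of that box get labels: vertical one $x$, horizontal one $y$. **Special box.** The special box of $T$ is the Northeast-most labeled box among the labeled boxes that occur at the bottom of a column. **Ribbon addition.** A ribbon is a set of boxes $D_2\setminus D_1$ ($D_1\subseteq D_2$ Ferrers diagrams) that is connected (by adjacency) and contains no $2\times2$ square. Given a vertical border edge $e_1$ and a horizontal border edge $e_2$ located to the Northeast of $e_1$ along the border, adding a ribbon between $e_1$ and $e_2$ means adding to the diagram, along its border, the ribbon of empty boxes whose Southwestern-most box is immediately to the right of $e_1$ and whose Northeastern-most box is immediately below $e_2$. Labels of border edges are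 shifted accordingly: each row keeps the label of its vertical border edge and each column keeps the label of its horizontal border edge. **Insertion procedure.** Input: an LTLT $T$ of size $n$, a border edge $e$ of $T$, a compatible bi-label $(x,y)$. 1. Find the special box $s$ of $T$. 2. Perform the column addition (if $e$ is vertical) or row addition (if $e$ is horizontal) at $e$ with new bi-label $(x,y)$. 3. If $e$ is to the left of $s$ (i.e. $e$ strictly precedes the horizontal border edge just below $s$ when the border of $T$ is traversed from Southwest to Northeast), add a ribbon between the vertical border edge immediately to the right of the new labeled box and the horizontal border edge immediately below $s$. Output: the resulting tableau $T'$. *)

theory Defs
  imports Main
begin

text \<open>
  A box is a pair (row, column). Rows are counted from top to bottom and columns from left
  to right, both starting with 0, so that the root box is \<open>(0, 0)\<close>.
\<close>

type_synonym box = "nat \<times> nat"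

definition ferrers :: "box set \<Rightarrow> bool" where
  "ferrers D \<longleftrightarrow> finite D \<and> (\<forall>i j i' j'. (i, j) \<in> D \<and> i' \<le> i \<and> j' \<le> j \<longrightarrow> (i', j') \<in> D)"

definition row_len :: "box set \<Rightarrow> nat \<Rightarrow> nat" where
  "row_len D r = card {j. (r, j) \<in> D}"

definition col_len :: "box set \<Rightarrow> nat \<Rightarrow> nat" where
  "col_len D c = card {i. (i, c) \<in> D}"

text \<open>
  \<open>V r\<close> is the vertical border edge at the end of row \<open>r\<close> and \<open>H c\<close> the horizontal
  border edge at the bottom of column \<open>c\<close>.
\<close>

datatype edge = V nat | H nat

definition border_edges :: "box set \<Rightarrow> edge set" where
  "border_edges D = V ` fst ` D \<union> H ` snd ` D"

definition half_perimeter :: "box set \<Rightarrow> nat" where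
  "half_perimeter D = card (border_edges D)"

text \<open>
  The value of (column coordinate - row coordinate) at the Southwestern end of an edge. A step
  along the border from Southwest to Northeast goes one unit right or one unit up and hence
  increases it by exactly 1: border edges are traversed in increasing order of \<open>pos\<close>.
\<close>

fun pos :: "box set \<Rightarrow> edge \<Rightarrow> int" where
  "pos D (V r) = int (row_len D r) - int (Suc r)"
| "pos D (H c) = int c - int (col_len D c)"

definition precedes :: "box set \<Rightarrow> edge \<Rightarrow> edge \<Rightarrow> bool" where
  "precedes D e f \<longleftrightarrow> pos D e < pos D f"

datatype label = One | Alpha | Beta | Gamma | Delta

text \<open>An empty box has label \<open>None\<close>.\<close>

record tableau =
  shape :: "box set"
  box_label :: "box \<Rightarrow> label option"
  edge_label :: "edge \<Rightarrow> label option"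

definition L_boxes :: "tableau \<Rightarrow> box \<Rightarrow> box set" where
  "L_boxes T c = {b \<in> shape T. snd b = snd c \<and> fst b < fst c}"

definition A_boxes :: "tableau \<Rightarrow> box \<Rightarrow> box set" where
  "A_boxes T c = {b \<in> shape T. fst b = fst c \<and> snd b < snd c}"

text \<open>
  The domain conditions fix the label functions outside the diagram, so that equality of
  records is equality of tableaux.
\<close>

definition LTLT :: "nat \<Rightarrow> tableau \<Rightarrow> bool" where
  "LTLT n T \<longleftrightarrow>
     ferrers (shape T) \<and>
     half_perimeter (shape T) = n + 1 \<and>
     dom (box_label T) \<subseteq> shape T \<and>
     dom (edge_label T) = border_edges (shape T) \<and>
     box_label T (0, 0) = Some One \<and>
     (\<forall>i j l. box_label T (i, j) = Some l \<longrightarrow> (l = One \<longleftrightarrow> i = 0 \<or> j = 0)) \<and>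
     (\<forall>e l. edge_label T e = Some l \<longrightarrow> (l = One \<longleftrightarrow> e = V 0 \<or> e = H 0)) \<and>
     (\<forall>r l. r \<noteq> 0 \<and> edge_label T (V r) = Some l \<longrightarrow> l \<in> {Alpha, Gamma}) \<and>
     (\<forall>c l. c \<noteq> 0 \<and> edge_label T (H c) = Some l \<longrightarrow> l \<in> {Beta, Delta}) \<and>
     (\<forall>i \<in> fst ` shape T. \<exists>j. (i, j) \<in> dom (box_label T)) \<and>
     (\<forall>j \<in> snd ` shape T. \<exists>i. (i, j) \<in> dom (box_label T)) \<and>
     (\<forall>c. box_label T c \<in> {Some Alpha, Some Gamma} \<longrightarrow>
        L_boxes T c \<inter> dom (box_label T) = {} \<and> A_boxes T c \<inter> dom (box_label T) \<noteq> {}) \<and>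
     (\<forall>c. box_label T c \<in> {Some Beta, Some Delta} \<longrightarrow>
        A_boxes T c \<inter> dom (box_label T) = {} \<and> L_boxes T c \<inter> dom (box_label T) \<noteq> {})"

fun compatible :: "edge \<Rightarrow> label \<times> label \<Rightarrow> bool" where
  "compatible e (x, y) \<longleftrightarrow>
     (if e = V 0 then x = One \<and> y \<in> {Beta, Delta}
      else if e = H 0 then y = One \<and> x \<in> {Alpha, Gamma}
      else x \<in> {Alpha, Gamma} \<and> y \<in> {Beta, Delta})"

text \<open>The index, after the insertion of a new line (row or column) number \<open>k\<close>, of old line \<open>j\<close>.\<close>

definition shift :: "nat \<Rightarrow> nat \<Rightarrow> nat" where
  "shift k j = (if j < k then j else Suc j)"

definition column_addition :: "tableau \<Rightarrow> nat \<Rightarrow> label \<times> label \<Rightarrow> tableau" where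
  "column_addition T r xy =
     (let k = row_len (shape T) r in
      \<lparr>shape = (\<lambda>(i, j). (i, shift k j)) ` shape T \<union> {(i, k) | i. i \<le> r},
       box_label = (\<lambda>(i, j).
         if j < k then box_label T (i, j)
         else if j = k then (if i = r then edge_label T (V r) else None)
         else box_label T (i, j - 1)),
       edge_label = (\<lambda>e. case e of
           V i \<Rightarrow> if i = r then Some (fst xy) else edge_label T (V i)
         | H j \<Rightarrow> if j < k then edge_label T (H j)
                  else if j = k then Some (snd xy)
                  else edge_label T (H (j - 1)))\<rparr>)"

definition row_addition :: "tableau \<Rightarrow> nat \<Rightarrow> label \<times> label \<Rightarrow> tableau" where
  "row_addition T c xy =
     (let k = col_len (shape T) c in
      \<lparr>shape = (\<lambda>(i, j). (shift k i, j)) ` shape T \<union> {(k, j) | j. j \<le> c},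
       box_label = (\<lambda>(i, j).
         if i < k then box_label T (i, j)
         else if i = k then (if j = c then edge_label T (H c) else None)
         else box_label T (i - 1, j)),
       edge_label = (\<lambda>e. case e of
           V i \<Rightarrow> if i < k then edge_label T (V i)
                  else if i = k then Some (fst xy)
                  else edge_label T (V (i - 1))
         | H j \<Rightarrow> if j = c then Some (snd xy) else edge_label T (H j))\<rparr>)"

definition southwestern_most :: "box set \<Rightarrow> box \<Rightarrow> bool" where
  "southwestern_most S b \<longleftrightarrow> b \<in> S \<and> (\<forall>b' \<in> S. fst b' \<le> fst b \<and> snd b \<le> snd b')"

definition northeastern_most :: "box set \<Rightarrow> box \<Rightarrow> bool" where
  "northeastern_most S b \<longleftrightarrow> b \<in> S \<and> (\<forall>b' \<in> S. fst b \<le> fst b' \<and> snd b' \<le> snd b)"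

definition special_box :: "tableau \<Rightarrow> box" where
  "special_box T =
     (THE s. northeastern_most
        {(i, j). (i, j) \<in> shape T \<and> (Suc i, j) \<notin> shape T \<and> (i, j) \<in> dom (box_label T)} s)"

definition adjacent :: "box \<Rightarrow> box \<Rightarrow> bool" where
  "adjacent a b \<longleftrightarrow>
     fst a = fst b \<and> (snd a = Suc (snd b) \<or> snd b = Suc (snd a)) \<or>
     snd a = snd b \<and> (fst a = Suc (fst b) \<or> fst b = Suc (fst a))"

definition connected_boxes :: "box set \<Rightarrow> bool" where
  "connected_boxes R \<longleftrightarrow>
     (\<forall>a \<in> R. \<forall>b \<in> R. (a, b) \<in> {(p, q). p \<in> R \<and> q \<in> R \<and> adjacent p q}\<^sup>*)"

definition ribbon :: "box set \<Rightarrow> box set \<Rightarrow> bool" where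
  "ribbon D1 D2 \<longleftrightarrow>
     ferrers D1 \<and> ferrers D2 \<and> D1 \<subseteq> D2 \<and>
     connected_boxes (D2 - D1) \<and>
     \<not> (\<exists>i j. {(i, j), (i, Suc j), (Suc i, j), (Suc i, Suc j)} \<subseteq> D2 - D1)"

text \<open>
  Adding a ribbon between the border edges \<open>V r\<close> and \<open>H c\<close>. The box to the right of \<open>V r\<close> is
  \<open>(r, row_len D r)\<close> and the box below \<open>H c\<close> is \<open>(col_len D c, c)\<close>. Since edge labels are
  indexed by rows and columns, they need not be changed.
\<close>

definition add_ribbon :: "tableau \<Rightarrow> nat \<Rightarrow> nat \<Rightarrow> tableau" where
  "add_ribbon T r c =
     T\<lparr>shape := (THE D'. ribbon (shape T) D' \<and>
          southwestern_most (D' - shape T) (r, row_len (shape T) r) \<and>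
          northeastern_most (D' - shape T) (col_len (shape T) c, c))\<rparr>"

text \<open>
  The special box is determined before the addition; a column addition may move it to the right,
  which is why its column is shifted in the first case. In the second case, the new labeled box
  lies in the new row \<open>col_len (shape T) c\<close>.
\<close>

fun insertion :: "tableau \<Rightarrow> edge \<Rightarrow> label \<times> label \<Rightarrow> tableau" where
  "insertion T (V r) xy =
     (let s = special_box T; T' = column_addition T r xy in
      if precedes (shape T) (V r) (H (snd s))
      then add_ribbon T' r (shift (row_len (shape T) r) (snd s))
      else T')"
| "insertion T (H c) xy =
     (let s = special_box T; T' = row_addition T c xy in
      if precedes (shape T) (H c) (H (snd s))
      then add_ribbon T' (col_len (shape T) c) (snd s)
      else T')"

end

theory Submission
  imports Defs
begin

text \<open>
  Insertion factors through labelled tree-like tableaux of size \<open>n + 1\<close> with a marked labelled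
  corner.

  A row or column addition yields such a tableau \<open>U\<close>, whose marked corner \<open>p\<close> is the new labelled
  box. The label of \<open>p\<close> tells which addition took place: a box labelled \<open>\<alpha>\<close> or \<open>\<gamma>\<close> has no label
  above it and, being a corner, no box below it, so that it carries the only label of its column,
  and some label stands to its left, so that its row survives the deletion of that column. A box
  labelled \<open>\<beta>\<close> or \<open>\<delta>\<close> behaves in the same way with rows and columns exchanged, and for the label
  \<open>1\<close> the position decides. Deleting the column or row of \<open>p\<close>, and letting the label of \<open>p\<close> become
  the label of a border edge, is therefore inverse to the addition: this is \<open>bij_betw_add_line\<close>.
  Reflection across the main diagonal exchanges the two cases, so that here only columns need be
  treated.

  The ribbon step depends on \<open>(U, p)\<close> alone: the edge \<open>e\<close> lies to the left of the special box \<open>s\<close>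
  of \<open>T\<close> exactly if \<open>p\<close> is not the special box of \<open>U\<close>, and then \<open>s\<close>, shifted, is the special box of
  \<open>U\<close> (\<open>insertion_V_eq\<close>, \<open>insertion_H_eq\<close>). The ribbon puts an empty box at the bottom of every
  column to the right of \<open>p\<close> up to the column of \<open>s\<close>, and the later columns end in empty boxes
  anyway; hence \<open>p\<close> is the special box of the result and can be read off from it. A ribbon was
  added exactly if there is a box to the right of \<open>p\<close>. In that case it is recovered by walking
  along the rim from that box towards the Northeast, until the next step would enter a labelled
  box. Such a box is reached from below, because the bottoms of the columns to the right of \<open>p\<close>
  are empty; and it exists, because the walk covers the whole last column, in which some box is
  labelled. This is \<open>bij_betw_close_ribbon\<close>.
\<close>

section \<open>Ferrers diagrams\<close>

lemma ferrersD: "ferrers D \<Longrightarrow> (i, j) \<in> D \<Longrightarrow> i' \<le> i \<Longrightarrow> j' \<le> j \<Longrightarrow> (i', j') \<in> D"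
  unfolding ferrers_def by blast

lemma mem_iff_less_card:
  fixes S :: "nat set"
  assumes "finite S" and down: "\<And>x y. y \<in> S \<Longrightarrow> x \<le> y \<Longrightarrow> x \<in> S"
  shows "x \<in> S \<longleftrightarrow> x < card S"
proof
  assume "x \<in> S"
  then have "{..x} \<subseteq> S" using down by auto
  from card_mono[OF assms(1) this] show "x < card S" by simp
next
  assume "x < card S"
  show "x \<in> S"
  proof (rule ccontr)
    assume "x \<notin> S"
    then have "S \<subseteq> {..<x}" using down by (meson lessThan_iff linorder_not_le subsetI)
    from card_mono[OF _ this] show False using \<open>x < card S\<close> by simp
  qed
qed

lemma less_row_len_iff:
  assumes "ferrers D" shows "j < row_len D r \<longleftrightarrow> (r, j) \<in> D"
proof -
  have "{j. (r, j) \<in> D} \<subseteq> snd ` D" by force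
  then have "finite {j. (r, j) \<in> D}"
    using assms finite_subset unfolding ferrers_def by blast
  from mem_iff_less_card[OF this, of j] show ?thesis
    using ferrersD[OF assms] unfolding row_len_def by auto
qed

lemma less_col_len_iff:
  assumes "ferrers D" shows "i < col_len D c \<longleftrightarrow> (i, c) \<in> D"
proof -
  have "{i. (i, c) \<in> D} \<subseteq> fst ` D" by force
  then have "finite {i. (i, c) \<in> D}"
    using assms finite_subset unfolding ferrers_def by blast
  from mem_iff_less_card[OF this, of i] show ?thesis
    using ferrersD[OF assms] unfolding col_len_def by auto
qed

lemma row_len_eqI: "ferrers D \<Longrightarrow> (\<And>j. (r, j) \<in> D \<longleftrightarrow> j < k) \<Longrightarrow> row_len D r = k"
  by (metis less_row_len_iff linorder_neqE_nat order_less_irrefl)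

lemma V_in_border_edges: "ferrers D \<Longrightarrow> V i \<in> border_edges D \<longleftrightarrow> (i, 0) \<in> D"
  unfolding border_edges_def by (force dest: ferrersD)

lemma H_in_border_edges: "ferrers D \<Longrightarrow> H j \<in> border_edges D \<longleftrightarrow> (0, j) \<in> D"
  unfolding border_edges_def by (force dest: ferrersD)

section \<open>Shape and filling of a tableau\<close>

text \<open>
  All conditions on the labels alone. Once labels outside the diagram are excluded, the boxes
  above or to the left of a given box need not be restricted to the diagram, so that these
  conditions survive any change of shape that keeps all labelled boxes.
\<close>
definition filling :: "(box \<Rightarrow> label option) \<Rightarrow> (edge \<Rightarrow> label option) \<Rightarrow> bool" where
  "filling B E \<longleftrightarrow>
     B (0, 0) = Some One \<and>
     (\<forall>i j l. B (i, j) = Some l \<longrightarrow> (l = One \<longleftrightarrow> i = 0 \<or> j = 0)) \<and>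
     (\<forall>e l. E e = Some l \<longrightarrow> (l = One \<longleftrightarrow> e = V 0 \<or> e = H 0)) \<and>
     (\<forall>r l. r \<noteq> 0 \<and> E (V r) = Some l \<longrightarrow> l \<in> {Alpha, Gamma}) \<and>
     (\<forall>c l. c \<noteq> 0 \<and> E (H c) = Some l \<longrightarrow> l \<in> {Beta, Delta}) \<and>
     (\<forall>i. E (V i) \<noteq> None \<longrightarrow> (\<exists>j. B (i, j) \<noteq> None)) \<and>
     (\<forall>j. E (H j) \<noteq> None \<longrightarrow> (\<exists>i. B (i, j) \<noteq> None)) \<and>
     (\<forall>i j. B (i, j) \<in> {Some Alpha, Some Gamma} \<longrightarrow>
        (\<forall>i'<i. B (i', j) = None) \<and> (\<exists>j'<j. B (i, j') \<noteq> None)) \<and>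
     (\<forall>i j. B (i, j) \<in> {Some Beta, Some Delta} \<longrightarrow>
        (\<forall>j'<j. B (i, j') = None) \<and> (\<exists>i'<i. B (i', j) \<noteq> None))"

text \<open>
  Separates the shape from the filling. The half-perimeter is counted as the number of labelled
  edges, which makes it independent of the shape as well.
\<close>
lemma LTLT_iff_filling:
  "LTLT n T \<longleftrightarrow>
     ferrers (shape T) \<and> card (dom (edge_label T)) = n + 1 \<and>
     (\<forall>b. box_label T b \<noteq> None \<longrightarrow> b \<in> shape T) \<and>
     (\<forall>i. edge_label T (V i) \<noteq> None \<longleftrightarrow> (i, 0) \<in> shape T) \<and>
     (\<forall>j. edge_label T (H j) \<noteq> None \<longleftrightarrow> (0, j) \<in> shape T) \<and>
     filling (box_label T) (edge_label T)"
proof (cases "ferrers (shape T) \<and> dom (box_label T) \<subseteq> shape T \<and>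
              dom (edge_label T) = border_edges (shape T)")
  case True
  note f = conjunct1[OF True]
  have E: "edge_label T e \<noteq> None \<longleftrightarrow> e \<in> border_edges (shape T)" for e using True by blast
  have B: "box_label T b \<noteq> None \<Longrightarrow> b \<in> shape T" for b using True by blast
  have rows: "i \<in> fst ` shape T \<longleftrightarrow> edge_label T (V i) \<noteq> None" for i
    unfolding E border_edges_def by blast
  have cols: "j \<in> snd ` shape T \<longleftrightarrow> edge_label T (H j) \<noteq> None" for j
    unfolding E border_edges_def by blast
  have L: "L_boxes T (i, j) \<inter> dom (box_label T) = {} \<longleftrightarrow> (\<forall>i'<i. box_label T (i', j) = None)" for i j
    using B[of "(_, j)"] by (force simp: L_boxes_def domIff)
  have A: "A_boxes T (i, j) \<inter> dom (box_label T) = {} \<longleftrightarrow> (\<forall>j'<j. box_label T (i, j') = None)" for i j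
    using B[of "(i, _)"] by (force simp: A_boxes_def domIff)
  have B': "\<forall>i j. (\<exists>l. box_label T (i, j) = Some l) \<longrightarrow> (i, j) \<in> shape T" using B by blast
  show ?thesis
    unfolding LTLT_def filling_def half_perimeter_def Ball_def rows cols split_paired_All L A
    using True B' E V_in_border_edges[OF f] H_in_border_edges[OF f] by (simp add: domIff)
next
  case False
  have "dom (edge_label T) = border_edges (shape T)" if "ferrers (shape T)"
    "\<forall>i. edge_label T (V i) \<noteq> None \<longleftrightarrow> (i, 0) \<in> shape T"
    "\<forall>j. edge_label T (H j) \<noteq> None \<longleftrightarrow> (0, j) \<in> shape T"
  proof (rule set_eqI)
    fix e show "e \<in> dom (edge_label T) \<longleftrightarrow> e \<in> border_edges (shape T)"
      using that by (cases e) (auto simp: V_in_border_edges H_in_border_edges)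
  qed
  with False show ?thesis unfolding LTLT_def by blast
qed

section \<open>The special box\<close>

definition bottom_labels :: "tableau \<Rightarrow> box set" where
  "bottom_labels T =
     {(i, j). (i, j) \<in> shape T \<and> (Suc i, j) \<notin> shape T \<and> (i, j) \<in> dom (box_label T)}"

lemma bottom_labels_iff: "(i, j) \<in> bottom_labels T \<longleftrightarrow>
   (i, j) \<in> shape T \<and> (Suc i, j) \<notin> shape T \<and> box_label T (i, j) \<noteq> None"
  unfolding bottom_labels_def by blast

lemma bottom_order:
  assumes "ferrers D" "(i, j) \<in> D" "(Suc i', j') \<notin> D" "j' \<le> j"
  shows "i \<le> i'"
  using assms by (meson ferrersD not_less_eq_eq)

lemma bottom_labels_order:
  assumes "ferrers (shape T)" "a \<in> bottom_labels T" "b \<in> bottom_labels T" "snd a \<le> snd b"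
  shows "fst b \<le> fst a"
proof -
  obtain i j i' j' where ab: "a = (i, j)" "b = (i', j')" by force
  show ?thesis
    using bottom_order[OF assms(1), of i' j' i j] assms(2-4) unfolding ab bottom_labels_iff by simp
qed

text \<open>
  A column has only one bottom, and bottoms of later columns lie weakly higher; so being
  Northeast-most among them only requires to be in the last column.
\<close>
lemma special_box_eqI:
  assumes f: "ferrers (shape T)" and s: "s \<in> bottom_labels T"
    and max: "\<And>b. b \<in> bottom_labels T \<Longrightarrow> snd b \<le> snd s"
  shows "special_box T = s"
  unfolding special_box_def bottom_labels_def[symmetric]
proof (rule the_equality)
  show "northeastern_most (bottom_labels T) s"
    unfolding northeastern_most_def using s max bottom_labels_order[OF f _ s] by blast
next
  fix t assume "northeastern_most (bottom_labels T) t"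
  then have t: "t \<in> bottom_labels T" "snd s \<le> snd t" "fst t \<le> fst s"
    using s unfolding northeastern_most_def by auto
  moreover have "snd t \<le> snd s" "fst s \<le> fst t"
    using max t(1) bottom_labels_order[OF f t(1) s] by auto
  ultimately show "t = s" by (simp add: prod_eq_iff)
qed

lemma LTLT_filling:
  assumes "LTLT n T"
  shows "ferrers (shape T)" "card (dom (edge_label T)) = n + 1"
    "\<And>b. box_label T b \<noteq> None \<Longrightarrow> b \<in> shape T"
    "\<And>i. edge_label T (V i) \<noteq> None \<longleftrightarrow> (i, 0) \<in> shape T"
    "\<And>j. edge_label T (H j) \<noteq> None \<longleftrightarrow> (0, j) \<in> shape T"
    "filling (box_label T) (edge_label T)"
proof -
  note h = assms[unfolded LTLT_iff_filling]
  show "ferrers (shape T)" by (rule conjunct1[OF h])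
  note h = conjunct2[OF h]
  show "card (dom (edge_label T)) = n + 1" by (rule conjunct1[OF h])
  note h = conjunct2[OF h]
  show "b \<in> shape T" if "box_label T b \<noteq> None" for b
    using that by (rule conjunct1[OF h, rule_format])
  note h = conjunct2[OF h]
  show "edge_label T (V i) \<noteq> None \<longleftrightarrow> (i, 0) \<in> shape T" for i
    by (rule spec[OF conjunct1[OF h]])
  note h = conjunct2[OF h]
  show "edge_label T (H j) \<noteq> None \<longleftrightarrow> (0, j) \<in> shape T" for j
    by (rule spec[OF conjunct1[OF h]])
  show "filling (box_label T) (edge_label T)" by (rule conjunct2[OF h])
qed

lemmas LTLT_ferrers = LTLT_filling(1) and LTLT_box = LTLT_filling(3)

lemma fillingD:
  assumes "filling B E"
  shows "B (0, 0) = Some One"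
    "\<And>i j l. B (i, j) = Some l \<Longrightarrow> l = One \<longleftrightarrow> i = 0 \<or> j = 0"
    "\<And>e l. E e = Some l \<Longrightarrow> l = One \<longleftrightarrow> e = V 0 \<or> e = H 0"
    "\<And>r l. r \<noteq> 0 \<Longrightarrow> E (V r) = Some l \<Longrightarrow> l \<in> {Alpha, Gamma}"
    "\<And>c l. c \<noteq> 0 \<Longrightarrow> E (H c) = Some l \<Longrightarrow> l \<in> {Beta, Delta}"
    "\<And>i. E (V i) \<noteq> None \<Longrightarrow> \<exists>j. B (i, j) \<noteq> None"
    "\<And>j. E (H j) \<noteq> None \<Longrightarrow> \<exists>i. B (i, j) \<noteq> None"
    "\<And>i j i'. B (i, j) \<in> {Some Alpha, Some Gamma} \<Longrightarrow> i' < i \<Longrightarrow> B (i', j) = None"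
    "\<And>i j. B (i, j) \<in> {Some Alpha, Some Gamma} \<Longrightarrow> \<exists>j'<j. B (i, j') \<noteq> None"
    "\<And>i j j'. B (i, j) \<in> {Some Beta, Some Delta} \<Longrightarrow> j' < j \<Longrightarrow> B (i, j') = None"
    "\<And>i j. B (i, j) \<in> {Some Beta, Some Delta} \<Longrightarrow> \<exists>i'<i. B (i', j) \<noteq> None"
proof -
  note h = assms[unfolded filling_def]
  show "B (0, 0) = Some One" by (rule conjunct1[OF h])
  note h = conjunct2[OF h]
  show "l = One \<longleftrightarrow> i = 0 \<or> j = 0" if "B (i, j) = Some l" for i j l
    using conjunct1[OF h] that by blast
  note h = conjunct2[OF h]
  show "l = One \<longleftrightarrow> e = V 0 \<or> e = H 0" if "E e = Some l" for e l
    using conjunct1[OF h] that by blast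
  note h = conjunct2[OF h]
  show "l \<in> {Alpha, Gamma}" if "r \<noteq> 0" "E (V r) = Some l" for r l
    using conjunct1[OF h] that by blast
  note h = conjunct2[OF h]
  show "l \<in> {Beta, Delta}" if "c \<noteq> 0" "E (H c) = Some l" for c l
    using conjunct1[OF h] that by blast
  note h = conjunct2[OF h]
  show "\<exists>j. B (i, j) \<noteq> None" if "E (V i) \<noteq> None" for i
    by (rule conjunct1[OF h, THEN spec, THEN mp, OF that])
  note h = conjunct2[OF h]
  show "\<exists>i. B (i, j) \<noteq> None" if "E (H j) \<noteq> None" for j
    by (rule conjunct1[OF h, THEN spec, THEN mp, OF that])
  note h = conjunct2[OF h]
  show "B (i', j) = None" if "B (i, j) \<in> {Some Alpha, Some Gamma}" "i' < i" for i j i'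
    using conjunct1[OF h, THEN spec, THEN spec, THEN mp, OF that(1)] that(2) by blast
  show "\<exists>j'<j. B (i, j') \<noteq> None" if "B (i, j) \<in> {Some Alpha, Some Gamma}" for i j
    by (rule conjunct1[OF h, THEN spec, THEN spec, THEN mp, OF that, THEN conjunct2])
  note h = conjunct2[OF h]
  show "B (i, j') = None" if "B (i, j) \<in> {Some Beta, Some Delta}" "j' < j" for i j j'
    using h[THEN spec, THEN spec, THEN mp, OF that(1)] that(2) by blast
  show "\<exists>i'<i. B (i', j) \<noteq> None" if "B (i, j) \<in> {Some Beta, Some Delta}" for i j
    by (rule h[THEN spec, THEN spec, THEN mp, OF that, THEN conjunct2])
qed

lemma LTLT_row: "LTLT n T \<Longrightarrow> (i, 0) \<in> shape T \<Longrightarrow> \<exists>j. box_label T (i, j) \<noteq> None"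
  using LTLT_filling(4)[of n T i] fillingD(6)[OF LTLT_filling(6), of n T i] by simp

lemma LTLT_col: "LTLT n T \<Longrightarrow> (0, j) \<in> shape T \<Longrightarrow> \<exists>i. box_label T (i, j) \<noteq> None"
  using LTLT_filling(5)[of n T j] fillingD(7)[OF LTLT_filling(6), of n T j] by simp

lemma LTLT_root: "LTLT n T \<Longrightarrow> box_label T (0, 0) = Some One"
  by (rule fillingD(1)[OF LTLT_filling(6)])

text \<open>
  The special box exists: a label in the bottom row is at the bottom of its column.
\<close>
lemma special_box_props:
  assumes T: "LTLT n T"
  shows "special_box T \<in> bottom_labels T"
    and "b \<in> bottom_labels T \<Longrightarrow> snd b \<le> snd (special_box T)"
proof -
  note f = LTLT_ferrers[OF T]
  have fin: "finite (bottom_labels T)"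
    using f finite_subset[of "bottom_labels T" "shape T"]
    by (auto simp: ferrers_def bottom_labels_def)
  have "(0, 0) \<in> shape T" using LTLT_box[OF T] LTLT_root[OF T] by force
  then have "0 < col_len (shape T) 0" using less_col_len_iff[OF f] by blast
  then obtain m where m: "col_len (shape T) 0 = Suc m" using gr0_implies_Suc by blast
  then have m': "(m, 0) \<in> shape T" "(Suc m, 0) \<notin> shape T"
    using less_col_len_iff[OF f, of _ 0] by auto
  obtain j where "box_label T (m, j) \<noteq> None" using LTLT_row[OF T m'(1)] by blast
  then have "(m, j) \<in> bottom_labels T"
    using m' LTLT_box[OF T] ferrersD[OF f, of "Suc m" j "Suc m" 0] by (auto simp: bottom_labels_iff)
  then have ne: "snd ` bottom_labels T \<noteq> {}" by blast
  obtain s where s: "s \<in> bottom_labels T" "snd s = Max (snd ` bottom_labels T)"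
    using Max_in[OF _ ne] fin by auto
  have max: "snd b \<le> snd s" if "b \<in> bottom_labels T" for b
    using s fin that by simp
  have "special_box T = s" by (rule special_box_eqI[OF f s(1) max])
  then show "special_box T \<in> bottom_labels T"
    and "b \<in> bottom_labels T \<Longrightarrow> snd b \<le> snd (special_box T)"
    using s(1) max by auto
qed

section \<open>Ribbons in closed form\<close>

text \<open>
  A ribbon contains no \<open>2 \<times> 2\<close> square, so each of its boxes is the diagonal successor of a box
  of the diagram. This gives the ribbon from the end of row \<open>r\<close> to the bottom of column \<open>c\<close>
  in closed form.
\<close>
definition ribbon_shape :: "box set \<Rightarrow> nat \<Rightarrow> nat \<Rightarrow> box set" where
  "ribbon_shape D r c = D \<union> {(Suc i, Suc j) |i j. (i, j) \<in> D \<and> i < r \<and> j < c}"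

lemma Suc_in_ribbon_shape:
  "(Suc i, Suc j) \<in> ribbon_shape D r c \<longleftrightarrow> (Suc i, Suc j) \<in> D \<or> (i, j) \<in> D \<and> i < r \<and> j < c"
  unfolding ribbon_shape_def by blast

lemma ribbon_shape_border:
  "(i, 0) \<in> ribbon_shape D r c \<longleftrightarrow> (i, 0) \<in> D" "(0, j) \<in> ribbon_shape D r c \<longleftrightarrow> (0, j) \<in> D"
  unfolding ribbon_shape_def by auto

lemma ribbon_shape_minus: "(i, j) \<in> ribbon_shape D r c - D \<longleftrightarrow>
   (i, j) \<notin> D \<and> (\<exists>i' j'. i = Suc i' \<and> j = Suc j' \<and> (i', j') \<in> D \<and> i' < r \<and> j' < c)"
  unfolding ribbon_shape_def by blast

lemma ferrers_ribbon_shape: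
  assumes f: "ferrers D" and r: "(r, 0) \<in> D" and c: "(0, c) \<in> D"
  shows "ferrers (ribbon_shape D r c)"
  unfolding ferrers_def
proof (intro conjI allI impI)
  have "{(Suc i, Suc j) |i j. (i, j) \<in> D \<and> i < r \<and> j < c} \<subseteq> (\<lambda>(i, j). (Suc i, Suc j)) ` D" by auto
  then show "finite (ribbon_shape D r c)"
    using f finite_subset unfolding ribbon_shape_def ferrers_def by blast
next
  fix i j i' j'
  assume a: "(i, j) \<in> ribbon_shape D r c \<and> i' \<le> i \<and> j' \<le> j"
  show "(i', j') \<in> ribbon_shape D r c"
  proof (cases "(i, j) \<in> D")
    case True
    then show ?thesis using ferrersD[OF f] a unfolding ribbon_shape_def by blast
  next
    case False
    then obtain a0 b0 where ab: "i = Suc a0" "j = Suc b0" "(a0, b0) \<in> D" "a0 < r" "b0 < c"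
      using a unfolding ribbon_shape_def by blast
    show ?thesis
    proof (cases i')
      case 0
      then have "(i', j') \<in> D" using ferrersD[OF f c] ab a by simp
      then show ?thesis unfolding ribbon_shape_def by blast
    next
      case (Suc a1)
      show ?thesis
      proof (cases j')
        case 0
        then have "(i', j') \<in> D" using ferrersD[OF f r] ab a by simp
        then show ?thesis unfolding ribbon_shape_def by blast
      next
        fix b1 assume "j' = Suc b1"
        then show ?thesis using Suc Suc_in_ribbon_shape[of a1 b1] ferrersD[OF f ab(3), of a1 b1] ab a by simp
      qed
    qed
  qed
qed

text \<open>
  Discrete intermediate value theorem. It is applied to the content (column minus row), which
  changes by one between adjacent boxes; a connected ribbon thus meets every diagonal between its
  two ends.
\<close>
lemma rtrancl_intermediate_value:
  fixes h :: "'a \<Rightarrow> int"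
  assumes "(a, b) \<in> R\<^sup>*" and step: "\<And>p q. (p, q) \<in> R \<Longrightarrow> h q \<le> h p + 1"
    and "h a \<le> d" "d \<le> h b"
  shows "\<exists>p. (a, p) \<in> R\<^sup>* \<and> h p = d"
  using assms(1,4)
proof (induction rule: rtrancl_induct)
  case base
  then show ?case using assms(3) by (intro exI[of _ a]) auto
next
  case (step p q)
  show ?case
  proof (cases "d \<le> h p")
    case True
    then show ?thesis using step.IH by blast
  next
    case False
    then have "h q = d" using assms(2)[OF step.hyps(2)] step.prems by linarith
    then show ?thesis using rtrancl.rtrancl_into_rtrancl[OF step.hyps] by blast
  qed
qed

context
  fixes D r c
  assumes f: "ferrers D" and r: "(r, 0) \<in> D" and c: "(0, c) \<in> D" and rc: "(r, c) \<notin> D"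
begin

lemma row_len_pos: "0 < row_len D r" "row_len D r \<le> c"
  using less_row_len_iff[OF f, of _ r] r rc by (auto simp: not_less[symmetric])

lemma col_len_pos: "0 < col_len D c" "col_len D c \<le> r"
  using less_col_len_iff[OF f, of _ c] c rc by (auto simp: not_less[symmetric])

lemma start_in_ribbon: "(r, row_len D r) \<in> ribbon_shape D r c - D"
proof -
  obtain k where k: "row_len D r = Suc k" using row_len_pos gr0_implies_Suc by blast
  obtain q where q: "r = Suc q" using rc c by (cases r) auto
  have "(r, k) \<in> D" using less_row_len_iff[OF f, of k r] k by simp
  then have "(q, k) \<in> D" using ferrersD[OF f] q by auto
  then show ?thesis unfolding ribbon_shape_minus using k q row_len_pos less_row_len_iff[OF f, of "row_len D r" r]
    by auto
qed

lemma end_in_ribbon: "(col_len D c, c) \<in> ribbon_shape D r c - D"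
proof -
  obtain k where k: "col_len D c = Suc k" using col_len_pos gr0_implies_Suc by blast
  obtain q where q: "c = Suc q" using rc r by (cases c) auto
  have "(k, c) \<in> D" using less_col_len_iff[OF f, of k c] k by simp
  then have "(k, q) \<in> D" using ferrersD[OF f] q by auto
  then show ?thesis unfolding ribbon_shape_minus using k q col_len_pos less_col_len_iff[OF f, of "col_len D c" c]
    by auto
qed

lemma southwestern_most_ribbon:
  "southwestern_most (ribbon_shape D r c - D) (r, row_len D r)"
  unfolding southwestern_most_def
proof (intro conjI ballI start_in_ribbon)
  fix b assume b: "b \<in> ribbon_shape D r c - D"
  obtain i j where ij: "b = (i, j)" by force
  have "i \<le> r" "(i, j) \<notin> D" using b unfolding ij ribbon_shape_minus by auto
  moreover have "row_len D r \<le> j"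
  proof (rule ccontr)
    assume "\<not> row_len D r \<le> j"
    then have "(r, j) \<in> D" using less_row_len_iff[OF f, of j r] by simp
    then show False using ferrersD[OF f, of r j i j] calculation by simp
  qed
  ultimately show "fst b \<le> fst (r, row_len D r)" "snd (r, row_len D r) \<le> snd b" using ij by auto
qed

lemma northeastern_most_ribbon:
  "northeastern_most (ribbon_shape D r c - D) (col_len D c, c)"
  unfolding northeastern_most_def
proof (intro conjI ballI end_in_ribbon)
  fix b assume b: "b \<in> ribbon_shape D r c - D"
  obtain i j where ij: "b = (i, j)" by force
  have "j \<le> c" "(i, j) \<notin> D" using b unfolding ij ribbon_shape_minus by auto
  moreover have "col_len D c \<le> i"
  proof (rule ccontr)
    assume "\<not> col_len D c \<le> i"
    then have "(i, c) \<in> D" using less_col_len_iff[OF f, of i c] by simp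
    then show False using ferrersD[OF f, of i c i j] calculation by simp
  qed
  ultimately show "fst (col_len D c, c) \<le> fst b" "snd b \<le> snd (col_len D c, c)" using ij by auto
qed

text \<open>
  From every box of the ribbon but the Southwestern-most one, a step down or to the left stays
  in the ribbon. Both steps decrease the content, so that all boxes are connected to the same end.
\<close>
lemma ribbon_step:
  assumes ij: "(i, j) \<in> ribbon_shape D r c - D" and ne: "(i, j) \<noteq> (r, row_len D r)"
  shows "i < r \<and> (Suc i, j) \<in> ribbon_shape D r c - D \<or>
         (\<exists>j'. j = Suc j' \<and> (i, j') \<in> ribbon_shape D r c - D)"
proof -
  obtain a b where ab: "i = Suc a" "j = Suc b" "(a, b) \<in> D" "a < r" "b < c" and nD: "(i, j) \<notin> D"
    using ij unfolding ribbon_shape_minus by blast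
  show ?thesis
  proof (cases "(i, b) \<in> D")
    case True
    have "i \<noteq> r"
    proof
      assume "i = r"
      then have "j \<noteq> row_len D r" "b < row_len D r" "\<not> j < row_len D r"
        using ne True nD less_row_len_iff[OF f] by auto
      then show False using ab by simp
    qed
    then have "i < r" using ab by simp
    moreover have "(Suc i, j) \<notin> D" using nD ferrersD[OF f, of "Suc i" j i j] by auto
    ultimately show ?thesis unfolding ribbon_shape_minus using True ab by auto
  next
    case False
    have "b \<noteq> 0" using False ferrersD[OF f r, of i 0] ab by (cases b) auto
    then obtain b' where b': "b = Suc b'" using not0_implies_Suc by blast
    have "(a, b') \<in> D" using ferrersD[OF f ab(3)] b' by simp
    then show ?thesis unfolding ribbon_shape_minus using False ab b' by auto
  qed
qed

lemma connected_ribbon: "connected_boxes (ribbon_shape D r c - D)"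
proof -
  let ?R = "ribbon_shape D r c - D"
  let ?A = "{(p, q). p \<in> ?R \<and> q \<in> ?R \<and> adjacent p q}"
  have sym: "sym ?A" unfolding sym_def adjacent_def by auto
  have path: "(b, (r, row_len D r)) \<in> ?A\<^sup>*" if "b \<in> ?R" for b
    using that
  proof (induction "snd b + (r - fst b)" arbitrary: b rule: less_induct)
    case less
    obtain i j where ij: "b = (i, j)" by force
    show ?case
    proof (cases "b = (r, row_len D r)")
      case True
      then show ?thesis by simp
    next
      case False
      then consider "i < r" "(Suc i, j) \<in> ?R" | j' where "j = Suc j'" "(i, j') \<in> ?R"
        using ribbon_step[of i j] less.prems ij by blast
      then show ?thesis
      proof cases
        case 1
        have "((Suc i, j), (r, row_len D r)) \<in> ?A\<^sup>*"
          using less.hyps[of "(Suc i, j)"] 1 ij by auto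
        moreover have "(b, (Suc i, j)) \<in> ?A" using 1 ij less.prems by (simp add: adjacent_def)
        ultimately show ?thesis by (rule converse_rtrancl_into_rtrancl[rotated])
      next
        case 2
        have "((i, j'), (r, row_len D r)) \<in> ?A\<^sup>*"
          using less.hyps[of "(i, j')"] 2 ij by auto
        moreover have "(b, (i, j')) \<in> ?A" using 2 ij less.prems by (simp add: adjacent_def)
        ultimately show ?thesis by (rule converse_rtrancl_into_rtrancl[rotated])
      qed
    qed
  qed
  show ?thesis unfolding connected_boxes_def
  proof (intro ballI)
    fix a b assume "a \<in> ?R" "b \<in> ?R"
    from path[OF this(1)] symD[OF sym_rtrancl[OF sym] path[OF this(2)]]
    show "(a, b) \<in> ?A\<^sup>*" by (rule rtrancl_trans)
  qed
qed

lemma ribbon_ribbon_shape: "ribbon D (ribbon_shape D r c)"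
proof -
  have "\<not> {(i, j), (i, Suc j), (Suc i, j), (Suc i, Suc j)} \<subseteq> ribbon_shape D r c - D" for i j
    by (auto simp: Suc_in_ribbon_shape)
  then show ?thesis
    unfolding ribbon_def using f ferrers_ribbon_shape[OF f r c] connected_ribbon
    by (auto simp: ribbon_shape_def)
qed

text \<open>
  One inclusion holds because a ribbon contains no square. For the other, the ribbon meets the
  diagonal of each candidate box, and it can meet a diagonal only in the first box outside of
  the diagram.
\<close>
lemma ribbon_shape_unique:
  assumes rib: "ribbon D D'"
    and sw: "southwestern_most (D' - D) (r, row_len D r)"
    and ne: "northeastern_most (D' - D) (col_len D c, c)"
  shows "D' = ribbon_shape D r c"
proof -
  have f': "ferrers D'" and sub: "D \<subseteq> D'" and con: "connected_boxes (D' - D)"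
    and nsq: "\<And>i j. \<not> {(i, j), (i, Suc j), (Suc i, j), (Suc i, Suc j)} \<subseteq> D' - D"
    using rib unfolding ribbon_def by blast+
  have incl: "\<exists>a b. x = (Suc a, Suc b) \<and> (a, b) \<in> D \<and> a < r \<and> b < c" if x: "x \<in> D' - D" for x
  proof -
    obtain i j where ij: "x = (i, j)" by force
    have "i \<le> r" "row_len D r \<le> j" "col_len D c \<le> i" "j \<le> c"
      using sw ne x unfolding southwestern_most_def northeastern_most_def ij by force+
    moreover from this obtain a b where ab: "i = Suc a" "j = Suc b"
      using row_len_pos col_len_pos by (cases i; cases j) auto
    moreover have "(a, b) \<in> D"
    proof (rule ccontr)
      assume "(a, b) \<notin> D"
      then have "\<forall>p \<in> {(a, b), (a, Suc b), (Suc a, b), (Suc a, Suc b)}. p \<notin> D"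
        using ferrersD[OF f, of a "Suc b" a b] ferrersD[OF f, of "Suc a" b a b]
          ferrersD[OF f, of "Suc a" "Suc b" a b] by auto
      moreover have "\<forall>p \<in> {(a, b), (a, Suc b), (Suc a, b), (Suc a, Suc b)}. p \<in> D'"
        using ferrersD[OF f', of "Suc a" "Suc b"] x ij ab by auto
      ultimately show False using nsq[of a b] by blast
    qed
    ultimately show ?thesis using ij by auto
  qed
  show ?thesis
  proof
    show "D' \<subseteq> ribbon_shape D r c" using incl unfolding ribbon_shape_def by blast
  next
    have "(Suc i, Suc j) \<in> D'" if "(i, j) \<in> D" "i < r" "j < c" "(Suc i, Suc j) \<notin> D" for i j
    proof -
      let ?h = "\<lambda>p :: box. int (snd p) - int (fst p)"
      let ?A = "{(p, q). p \<in> D' - D \<and> q \<in> D' - D \<and> adjacent p q}"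
      let ?a = "(r, row_len D r)" and ?b = "(col_len D c, c)"
      have ends: "?a \<in> D' - D" "?b \<in> D' - D"
        using sw ne unfolding southwestern_most_def northeastern_most_def by auto
      have "(r, Suc j) \<notin> D" using that ferrersD[OF f, of r "Suc j" "Suc i" "Suc j"] by auto
      then have lo: "row_len D r \<le> Suc j" using less_row_len_iff[OF f] by (meson not_less)
      have "(Suc i, c) \<notin> D" using that ferrersD[OF f, of "Suc i" c "Suc i" "Suc j"] by auto
      then have hi: "col_len D c \<le> Suc i" using less_col_len_iff[OF f] by (meson not_less)
      have "(?a, ?b) \<in> ?A\<^sup>*" using con ends unfolding connected_boxes_def by blast
      then have "\<exists>p. (?a, p) \<in> ?A\<^sup>* \<and> ?h p = int j - int i"
        by (rule rtrancl_intermediate_value) (use lo hi that in \<open>auto simp: adjacent_def\<close>)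
      then obtain p where p: "(?a, p) \<in> ?A\<^sup>*" "?h p = int j - int i" by blast
      have "p \<in> D' - D" using p(1) ends by (cases rule: rtranclE) auto
      then obtain a b where ab: "p = (Suc a, Suc b)" "(a, b) \<in> D" "p \<in> D'" "p \<notin> D" using incl by blast
      have "a = i"
      proof (rule linorder_cases[of a i])
        assume "a < i"
        then show ?thesis using ab p(2) ferrersD[OF f that(1), of "Suc a" "Suc b"] by auto
      next
        assume "i < a"
        then show ?thesis using ab p(2) ferrersD[OF f ab(2), of "Suc i" "Suc j"] that by auto
      qed
      then show ?thesis using ab p(2) by auto
    qed
    then show "ribbon_shape D r c \<subseteq> D'" using sub unfolding ribbon_shape_def by blast
  qed
qed

end

lemma add_ribbon_eq:
  assumes "ferrers (shape T)" "(r, 0) \<in> shape T" "(0, c) \<in> shape T" "(r, c) \<notin> shape T"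
  shows "add_ribbon T r c = T\<lparr>shape := ribbon_shape (shape T) r c\<rparr>"
  unfolding add_ribbon_def
  using ribbon_ribbon_shape[OF assms] southwestern_most_ribbon[OF assms]
    northeastern_most_ribbon[OF assms] ribbon_shape_unique[OF assms]
  by (subst the_equality[of _ "ribbon_shape (shape T) r c"]) blast+

section \<open>Ribbons that start at a labelled corner\<close>

lemma LTLT_reshape:
  assumes "LTLT n T" "ferrers D"
    and "\<And>b. box_label T b \<noteq> None \<Longrightarrow> b \<in> D"
    and "\<And>i. (i, 0) \<in> D \<longleftrightarrow> (i, 0) \<in> shape T"
    and "\<And>j. (0, j) \<in> D \<longleftrightarrow> (0, j) \<in> shape T"
  shows "LTLT n (T\<lparr>shape := D\<rparr>)"
  using LTLT_filling[OF assms(1)] assms(2-) by (simp add: LTLT_iff_filling)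

text \<open>
  Adding a row or column leaves its labelled box in such a position.
\<close>
definition labelled_corner :: "tableau \<Rightarrow> box \<Rightarrow> bool" where
  "labelled_corner T p \<longleftrightarrow> p \<in> bottom_labels T \<and> (fst p, Suc (snd p)) \<notin> shape T"

text \<open>
  The third step of the insertion procedure, expressed by the tableau \<open>U\<close> after the row or
  column addition and its new labelled box \<open>p\<close>. The special box is here that of \<open>U\<close>.
\<close>
definition close_ribbon :: "tableau \<times> box \<Rightarrow> tableau" where
  "close_ribbon = (\<lambda>(U, p). if special_box U = p then U
                             else add_ribbon U (fst p) (snd (special_box U)))"

text \<open>
  The root is excluded since no addition creates it.
\<close>
definition marked_LTLTs :: "nat \<Rightarrow> (tableau \<times> box) set" where
  "marked_LTLTs n = {(U, p). LTLT n U \<and> labelled_corner U p \<and> p \<noteq> (0, 0)}"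

context
  fixes n U r k a c
  assumes U: "LTLT n U" and p: "labelled_corner U (r, k)" and s: "special_box U = (a, c)"
    and ne: "(a, c) \<noteq> (r, k)"
begin

lemma marked_ferrers: "ferrers (shape U)" by (rule LTLT_ferrers[OF U])

lemma marked_corner: "(r, k) \<in> shape U" "(Suc r, k) \<notin> shape U" "(r, Suc k) \<notin> shape U"
  "box_label U (r, k) \<noteq> None"
  using p unfolding labelled_corner_def bottom_labels_iff by auto

lemma special_is_bottom: "(a, c) \<in> shape U" "(Suc a, c) \<notin> shape U" "box_label U (a, c) \<noteq> None"
  using special_box_props(1)[OF U] unfolding s bottom_labels_iff by auto

lemma marked_left_of_special: "k < c"
proof -
  have "k \<le> c"
    using special_box_props(2)[OF U, of "(r, k)"] p s unfolding labelled_corner_def by simp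
  moreover have "k \<noteq> c"
  proof
    assume "k = c"
    then have "a \<le> r" "r \<le> a"
      using bottom_order[OF marked_ferrers, of a c r k] bottom_order[OF marked_ferrers, of r k a c] special_is_bottom marked_corner by auto
    with \<open>k = c\<close> ne show False by simp
  qed
  ultimately show ?thesis by simp
qed

lemma special_above_marked: "a < r"
proof (rule ccontr)
  assume "\<not> a < r"
  then have "(r, Suc k) \<in> shape U" using ferrersD[OF marked_ferrers special_is_bottom(1), of r "Suc k"] marked_left_of_special by simp
  then show False using marked_corner by simp
qed

lemma close_ribbon_eq: "close_ribbon (U, (r, k)) = U\<lparr>shape := ribbon_shape (shape U) r c\<rparr>"
proof -
  have "(r, 0) \<in> shape U" "(0, c) \<in> shape U" "(r, c) \<notin> shape U"
    using ferrersD[OF marked_ferrers] marked_corner special_is_bottom marked_left_of_special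
    by (meson le0 order_refl Suc_leI)+
  then show ?thesis using add_ribbon_eq[OF marked_ferrers, of r c] s ne unfolding close_ribbon_def by auto
qed

lemma ferrers_closed: "ferrers (ribbon_shape (shape U) r c)"
  using ferrers_ribbon_shape[OF marked_ferrers] ferrersD[OF marked_ferrers marked_corner(1), of r 0] ferrersD[OF marked_ferrers special_is_bottom(1), of 0 c]
  by simp

lemma LTLT_close_ribbon: "LTLT n (close_ribbon (U, (r, k)))"
  unfolding close_ribbon_eq
proof (rule LTLT_reshape[OF U ferrers_closed])
  show "b \<in> ribbon_shape (shape U) r c" if "box_label U b \<noteq> None" for b
    using LTLT_box[OF U that] unfolding ribbon_shape_def by blast
qed (rule ribbon_shape_border)+

text \<open>
  The reason why the special box can be read off after the ribbon has been added: no old box,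
  hence no label, remains at the bottom of the columns crossed by the ribbon.
\<close>
lemma ribbon_covers_bottom:
  assumes "(i, j) \<in> ribbon_shape (shape U) r c" "(Suc i, j) \<notin> ribbon_shape (shape U) r c"
    and "k < j" "j \<le> c"
  shows "(i, j) \<notin> shape U"
proof
  assume ij: "(i, j) \<in> shape U"
  have "i < r"
  proof (rule ccontr)
    assume "\<not> i < r"
    then have "(r, Suc k) \<in> shape U" using ferrersD[OF marked_ferrers ij, of r "Suc k"] \<open>k < j\<close> by simp
    then show False using marked_corner by simp
  qed
  obtain j' where j': "j = Suc j'" using \<open>k < j\<close> by (cases j) auto
  have "(i, j') \<in> shape U" using ferrersD[OF marked_ferrers ij] j' by simp
  then show False using assms(2,4) \<open>i < r\<close> unfolding j' Suc_in_ribbon_shape by simp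
qed

lemma special_box_close_ribbon: "special_box (close_ribbon (U, (r, k))) = (r, k)"
  unfolding close_ribbon_eq
proof (rule special_box_eqI)
  have "(Suc r, k) \<notin> ribbon_shape (shape U) r c"
    using marked_corner by (auto simp: ribbon_shape_def)
  then show "(r, k) \<in> bottom_labels (U\<lparr>shape := ribbon_shape (shape U) r c\<rparr>)"
    using marked_corner by (simp add: bottom_labels_iff ribbon_shape_def)
next
  fix b assume b: "b \<in> bottom_labels (U\<lparr>shape := ribbon_shape (shape U) r c\<rparr>)"
  obtain i j where ij: "b = (i, j)" by force
  have D: "(i, j) \<in> ribbon_shape (shape U) r c" "(Suc i, j) \<notin> ribbon_shape (shape U) r c"
    "box_label U (i, j) \<noteq> None" using b unfolding ij bottom_labels_iff by auto
  have "(i, j) \<in> bottom_labels U"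
    using D LTLT_box[OF U D(3)] unfolding bottom_labels_iff ribbon_shape_def by blast
  then have "j \<le> c" using special_box_props(2)[OF U, of "(i, j)"] s by simp
  then have "\<not> k < j" using ribbon_covers_bottom[OF D(1,2)] LTLT_box[OF U D(3)] by blast
  then show "snd b \<le> snd (r, k)" using ij by simp
qed (simp add: ferrers_closed)

lemma ribbon_starts: "(r, Suc k) \<in> shape (close_ribbon (U, (r, k)))"
proof -
  obtain q where q: "r = Suc q" using special_above_marked by (cases r) auto
  have "(q, k) \<in> shape U" using ferrersD[OF marked_ferrers marked_corner(1)] q by simp
  then show ?thesis unfolding close_ribbon_eq using marked_left_of_special q by (simp add: Suc_in_ribbon_shape)
qed

end

section \<open>Recovering the ribbon\<close>

text \<open>
  Two ribbons that lead to the same tableau end in the same column; by symmetry one inequality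
  suffices. If the second ribbon went on beyond column \<open>c1\<close>, where the first one ends below the
  labelled box \<open>(a1, c1)\<close>, it would have to go around that box. The bottom \<open>b\<close> of column
  \<open>c1 + 1\<close> lies in a row weakly above \<open>a1\<close>, so that \<open>(b, c1)\<close>, like the labelled box, belongs to the
  second diagram; but then its diagonal successor,
  below the bottom of column \<open>c1 + 1\<close>, would belong to the common shape.
\<close>
lemma ribbon_end_not_left:
  assumes U1: "LTLT n U1" "labelled_corner U1 (r, k)" "special_box U1 = (a1, c1)" "(a1, c1) \<noteq> (r, k)"
    and U2: "LTLT n U2" "labelled_corner U2 (r, k)" "special_box U2 = (a2, c2)" "(a2, c2) \<noteq> (r, k)"
    and eq: "ribbon_shape (shape U1) r c1 = ribbon_shape (shape U2) r c2"
    and labels: "box_label U1 = box_label U2"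
  shows "c2 \<le> c1"
proof (rule ccontr)
  assume "\<not> c2 \<le> c1"
  then have c: "c1 < c2" by simp
  note f1 = marked_ferrers[OF U1] and f2 = marked_ferrers[OF U2]
  note s1 = special_is_bottom[OF U1] and s2 = special_is_bottom[OF U2]
  let ?D = "ribbon_shape (shape U2) r c2"
  have f: "ferrers ?D" by (rule ferrers_closed[OF U2])
  have k: "k < c1" by (rule marked_left_of_special[OF U1])
  \<comment> \<open>\<open>b\<close> is the bottom row of column \<open>c1 + 1\<close> after either ribbon has been added.\<close>
  have "(0, Suc c1) \<in> ?D"
    using ferrersD[OF marked_ferrers[OF U2] s2(1), of 0 "Suc c1"] c by (simp add: ribbon_shape_def)
  then have "0 < col_len ?D (Suc c1)" using less_col_len_iff[OF f] by blast
  then obtain b where b: "col_len ?D (Suc c1) = Suc b" using gr0_implies_Suc by blast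
  have b': "(b, Suc c1) \<in> ?D" "(Suc b, Suc c1) \<notin> ?D"
    using less_col_len_iff[OF f, of _ "Suc c1"] b by auto
  have "(b, Suc c1) \<in> shape U1"
    using b'(1) unfolding eq[symmetric] by (auto simp: ribbon_shape_def)
  then have "b \<le> a1" by (rule bottom_order[OF f1 _ s1(2)]) simp
  moreover have "(a1, c1) \<in> shape U2" using LTLT_box[OF U2(1)] s1(3) labels by simp
  ultimately have "(b, c1) \<in> shape U2" using ferrersD[OF f2] by blast
  moreover have "b < r" using \<open>b \<le> a1\<close> special_above_marked[OF U1] by simp
  ultimately show False using b'(2) c by (simp add: Suc_in_ribbon_shape)
qed

text \<open>
  A box of the second ribbon that belongs to the first diagram has its diagonal successor outside
  of the common shape. As the first diagram reaches no further than the second one in row \<open>r\<close> and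
  in column \<open>c\<close>, the box lies in neither of them; but then its diagonal successor is
  added by the first ribbon, a contradiction.
\<close>
lemma unribbon_subset:
  assumes f: "ferrers D2" and p: "(r, k) \<in> D2" "(r, Suc k) \<notin> D1" and s: "(a, c) \<in> D2" "(Suc a, c) \<notin> D1"
    and eq: "ribbon_shape D1 r c = ribbon_shape D2 r c"
    and f1: "ferrers D1"
  shows "D1 \<subseteq> D2"
proof
  fix x assume x: "x \<in> D1"
  show "x \<in> D2"
  proof (rule ccontr)
    assume nx: "x \<notin> D2"
    have "x \<in> ribbon_shape D2 r c" using x eq[symmetric] by (simp add: ribbon_shape_def)
    with nx obtain i j where ij: "x = (Suc i, Suc j)" "(i, j) \<in> D2" "i < r" "j < c"
      unfolding ribbon_shape_def by blast
    have "Suc i \<noteq> r"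
    proof
      assume r: "Suc i = r"
      then have "Suc j \<le> k" using ferrersD[OF f1, of r "Suc j" r "Suc k"] x ij p by (cases "Suc j \<le> k") auto
      then show False using ferrersD[OF f p(1), of "Suc i" "Suc j"] r nx ij by simp
    qed
    moreover have "Suc j \<noteq> c"
    proof
      assume c: "Suc j = c"
      then have "Suc i \<le> a" using ferrersD[OF f1, of "Suc i" c "Suc a" c] x ij s by (cases "Suc i \<le> a") auto
      then show False using ferrersD[OF f s(1), of "Suc i" "Suc j"] c nx ij by simp
    qed
    ultimately have "(Suc (Suc i), Suc (Suc j)) \<in> ribbon_shape D1 r c"
      using x ij by (simp add: Suc_in_ribbon_shape)
    then have "(Suc (Suc i), Suc (Suc j)) \<in> D2 \<or> (Suc i, Suc j) \<in> D2"
      unfolding eq Suc_in_ribbon_shape by blast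
    then show False using ferrersD[OF f, of "Suc (Suc i)" "Suc (Suc j)" "Suc i" "Suc j"] nx ij by auto
  qed
qed

lemma close_ribbon_no_ribbon_iff:
  assumes U: "LTLT n U" and p: "labelled_corner U (r, k)"
  shows "special_box U = (r, k) \<longleftrightarrow> (r, Suc k) \<notin> shape (close_ribbon (U, (r, k)))"
proof (cases "special_box U = (r, k)")
  case True
  then show ?thesis using p unfolding close_ribbon_def labelled_corner_def by simp
next
  case False
  then show ?thesis using ribbon_starts[OF U p, of "fst (special_box U)" "snd (special_box U)"] by simp
qed

lemma special_box_close_ribbon_marked:
  assumes "LTLT n U" "labelled_corner U p"
  shows "special_box (close_ribbon (U, p)) = p"
proof (cases "special_box U = p")
  case True
  then show ?thesis unfolding close_ribbon_def by simp
next
  case False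
  then show ?thesis
    using special_box_close_ribbon[of n U "fst p" "snd p" "fst (special_box U)" "snd (special_box U)"] assms
    by simp
qed

lemma close_ribbon_inj:
  assumes U1: "LTLT n U1" "labelled_corner U1 p1" and U2: "LTLT n U2" "labelled_corner U2 p2"
    and eq: "close_ribbon (U1, p1) = close_ribbon (U2, p2)"
  shows "U1 = U2 \<and> p1 = p2"
proof -
  have p: "p1 = p2"
    using special_box_close_ribbon_marked[OF U1] special_box_close_ribbon_marked[OF U2] eq by simp
  obtain r k where rk: "p1 = (r, k)" by force
  have iff: "special_box U1 = (r, k) \<longleftrightarrow> special_box U2 = (r, k)"
    using close_ribbon_no_ribbon_iff[of n _ r k] U1 U2 eq p rk by metis
  show ?thesis
  proof (cases "special_box U1 = (r, k)")
    case True
    then show ?thesis using iff eq p rk unfolding close_ribbon_def by simp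
  next
    case False
    obtain a1 c1 a2 c2 where s: "special_box U1 = (a1, c1)" "special_box U2 = (a2, c2)" by force
    have A1: "LTLT n U1" "labelled_corner U1 (r, k)" "special_box U1 = (a1, c1)" "(a1, c1) \<noteq> (r, k)"
      and A2: "LTLT n U2" "labelled_corner U2 (r, k)" "special_box U2 = (a2, c2)" "(a2, c2) \<noteq> (r, k)"
      using U1 U2 s False iff p rk by auto
    have "U1\<lparr>shape := ribbon_shape (shape U1) r c1\<rparr> = U2\<lparr>shape := ribbon_shape (shape U2) r c2\<rparr>"
      using eq rk p unfolding rk p[symmetric] close_ribbon_eq[OF A1] close_ribbon_eq[OF A2] by simp
    then have sh: "ribbon_shape (shape U1) r c1 = ribbon_shape (shape U2) r c2"
      and B: "box_label U1 = box_label U2" and E: "edge_label U1 = edge_label U2"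
      by (metis select_convs(1) surjective update_convs(1), metis select_convs(2) surjective update_convs(1),
          metis select_convs(3) surjective update_convs(1))
    have c: "c1 = c2"
      using ribbon_end_not_left[OF A1 A2 sh B] ribbon_end_not_left[OF A2 A1 sh[symmetric] B[symmetric]] by simp
    note f1 = marked_ferrers[OF A1] and f2 = marked_ferrers[OF A2]
    note s1 = special_is_bottom[OF A1] and s2 = special_is_bottom[OF A2]
    have s12: "(a1, c) \<in> shape U2" "(a2, c) \<in> shape U1" if "c = c1" for c
      using LTLT_box[OF A2(1), of "(a1, c)"] LTLT_box[OF A1(1), of "(a2, c)"] s1 s2 B c that by auto
    have a: "a1 = a2"
      using bottom_order[OF f1 s12(2)[OF refl] s1(2)] bottom_order[OF f2 s12(1)[OF c[symmetric]] s2(2)] by simp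
    have "shape U1 \<subseteq> shape U2"
      by (rule unribbon_subset[of _ r k _ a2 c2])
        (use f1 f2 marked_corner[OF A1] marked_corner[OF A2] s1 s2 a c sh in auto)
    moreover have "shape U2 \<subseteq> shape U1"
      by (rule unribbon_subset[of _ r k _ a1 c1])
        (use f1 f2 marked_corner[OF A1] marked_corner[OF A2] s1 s2 a c sh in auto)
    ultimately show ?thesis using B E p by (simp add: tableau.equality)
  qed
qed

text \<open>
  If there is a box to the right of the special box \<open>(r, k)\<close>, then a ribbon has to be removed. It
  consists of the rim boxes to the right of column \<open>k\<close> that precede the first labelled rim box
  \<open>(a, c)\<close> on the way to the Northeast. Each step of this walk
  increases the content by one, so that the order along the rim is the order of contents.
\<close>
lemma close_ribbon_surj:
  assumes T: "LTLT n T" and p: "special_box T = (r, k)"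
  shows "\<exists>U. LTLT n U \<and> labelled_corner U (r, k) \<and> close_ribbon (U, (r, k)) = T"
proof (cases "(r, Suc k) \<in> shape T")
  case False
  then show ?thesis
    using special_box_props(1)[OF T] T p
    by (intro exI[of _ T]) (simp add: labelled_corner_def close_ribbon_def)
next
  case start: True
  note f = LTLT_ferrers[OF T]
  note down = ferrersD[OF f]
  have p': "(r, k) \<in> shape T" "(Suc r, k) \<notin> shape T" "box_label T (r, k) \<noteq> None"
    using special_box_props(1)[OF T] unfolding p bottom_labels_iff by auto
  have no_bottom: "(Suc i, j) \<in> shape T" if "box_label T (i, j) \<noteq> None" "k < j" for i j
    using special_box_props(2)[OF T, of "(i, j)"] LTLT_box[OF T that(1)] that p
    unfolding bottom_labels_iff by fastforce
  define rim where "rim = {(i, j). (i, j) \<in> shape T \<and> (Suc i, Suc j) \<notin> shape T \<and> k < j}"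
  let ?h = "\<lambda>b :: box. int (snd b) - int (fst b)"
  have same: "x = y" if "x \<in> rim" "y \<in> rim" "?h x = ?h y" for x y
  proof -
    obtain i j i' j' where xy: "x = (i, j)" "y = (i', j')" by force
    have "\<not> i < i'" using that down[of i' j' "Suc i" "Suc j"] unfolding xy rim_def by auto
    moreover have "\<not> i' < i" using that down[of i j "Suc i'" "Suc j'"] unfolding xy rim_def by auto
    ultimately show ?thesis using that(3) unfolding xy by auto
  qed
  define M where "M = {b \<in> rim. box_label T b \<noteq> None}"
  have "finite M"
    using f finite_subset[of M "shape T"] unfolding M_def rim_def ferrers_def by auto
  \<comment> \<open>A labelled rim box exists in the last column, all of whose boxes lie on the rim.\<close>
  moreover have "M \<noteq> {}"
  proof -
    have "Suc k < row_len (shape T) 0"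
      using less_row_len_iff[OF f, of "Suc k" 0] down[OF start, of 0 "Suc k"] by simp
    then obtain J where J: "row_len (shape T) 0 = Suc J" "k < J" by (cases "row_len (shape T) 0") auto
    have J': "(0, J) \<in> shape T" "(0, Suc J) \<notin> shape T"
      using less_row_len_iff[OF f, of _ 0] J by auto
    obtain i where i: "box_label T (i, J) \<noteq> None" using LTLT_col[OF T J'(1)] by blast
    have "(i, J) \<in> M"
      using i LTLT_box[OF T i] J J' down[of "Suc i" "Suc J" 0 "Suc J"] unfolding M_def rim_def by auto
    then show ?thesis by blast
  qed
  ultimately have "Min (?h ` M) \<in> ?h ` M" and "\<And>b. b \<in> M \<Longrightarrow> Min (?h ` M) \<le> ?h b"
    using Min_in Min_le by auto
  then obtain s where s: "s \<in> M" "\<And>b. b \<in> M \<Longrightarrow> ?h s \<le> ?h b" by auto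
  obtain a c where ac: "s = (a, c)" by force
  have s': "(a, c) \<in> rim" "box_label T (a, c) \<noteq> None" "(a, c) \<in> shape T"
    "(Suc a, Suc c) \<notin> shape T" "k < c"
    using s(1) unfolding M_def ac rim_def by auto
  \<comment> \<open>The first labelled rim box is entered from below, so that the ribbon ends under it.\<close>
  have below: "(Suc a, c) \<in> shape T" using no_bottom s' by blast
  have "a < r"
  proof (rule ccontr)
    assume "\<not> a < r"
    then have "(Suc r, k) \<in> shape T" using down[OF below, of "Suc r" k] s'(5) by simp
    then show False using p' by simp
  qed
  define R where "R = {b \<in> rim. ?h b < ?h s}"
  have R_iff: "(i, j) \<in> R \<longleftrightarrow> (i, j) \<in> shape T \<and> (Suc i, Suc j) \<notin> shape T \<and> k < j \<and>
      int j - int i < int c - int a" for i j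
    unfolding R_def rim_def ac by auto
  define D where "D = shape T - R"
  have fD: "ferrers D" unfolding ferrers_def
  proof (intro conjI allI impI)
    show "finite D" using f unfolding D_def ferrers_def by simp
  next
    fix i j i' j' assume *: "(i, j) \<in> D \<and> i' \<le> i \<and> j' \<le> j"
    then have ij: "(i, j) \<in> shape T" "(i, j) \<notin> R" unfolding D_def by auto
    have "(i', j') \<notin> R"
    proof
      assume R: "(i', j') \<in> R"
      then have nrim: "(Suc i', Suc j') \<notin> shape T" and kj: "k < j'"
        and h: "int j' - int i' < int c - int a" unfolding R_iff by auto
      have "i' = i \<or> j' = j" using nrim down[OF ij(1), of "Suc i'" "Suc j'"] * by fastforce
      then show False
      proof
        assume i: "i' = i"
        have "(Suc i, Suc j) \<notin> shape T" using nrim down[of "Suc i" "Suc j" "Suc i" "Suc j'"] i * by auto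
        then have ge: "int c - int a \<le> int j - int i" using ij kj * unfolding R_iff by force
        \<comment> \<open>If a row lost a box but kept a box further to the right, the rim would reach the
          content of \<open>(a, c)\<close> within this row; but \<open>(a, c)\<close> is entered from below.\<close>
        define j0 where "j0 = nat (int c - int a + int i)"
        have j0: "int j0 = int c - int a + int i" "j' < j0" "j0 \<le> j"
          using h ge i unfolding j0_def by auto
        have "(i, j0) \<in> rim"
          unfolding rim_def
          using down[OF ij(1), of i j0] down[of "Suc i" "Suc j0" "Suc i" "Suc j'"] nrim i j0 kj by auto
        then have "(i, j0) = (a, c)" using same[OF _ s'(1), of "(i, j0)"] j0(1) by simp
        then have "(Suc i', Suc j') \<in> shape T" using down[OF below, of "Suc i'" "Suc j'"] i j0 by simp
        with nrim show False by simp
      next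
        assume j: "j' = j"
        have "(Suc i, Suc j) \<notin> shape T" using nrim down[of "Suc i" "Suc j" "Suc i'" "Suc j"] j * by auto
        then show False using ij(2) h ij(1) kj j * unfolding R_iff by auto
      qed
    qed
    then show "(i', j') \<in> D" using down[OF ij(1)] * unfolding D_def by blast
  qed
  have labelled_D: "b \<in> D" if "box_label T b \<noteq> None" for b
    using that s(2)[of b] LTLT_box[OF T that] unfolding D_def R_def M_def by force
  have R_row: "0 < i" if "(i, j) \<in> R" for i j
  proof (rule ccontr)
    assume "\<not> 0 < i"
    then have "j < c" "(Suc 0, Suc j) \<notin> shape T" using that unfolding R_iff by auto
    then show False using down[OF below, of "Suc 0" "Suc j"] by simp
  qed
  let ?U = "T\<lparr>shape := D\<rparr>"
  have U: "LTLT n ?U"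
  proof (rule LTLT_reshape[OF T fD labelled_D])
    show "(i, 0) \<in> D \<longleftrightarrow> (i, 0) \<in> shape T" for i using R_iff[of i 0] unfolding D_def by auto
    show "(0, j) \<in> D \<longleftrightarrow> (0, j) \<in> shape T" for j using R_row[of 0 j] unfolding D_def by auto
  qed
  have "(Suc a, c) \<in> R"
    using below s' down[of "Suc (Suc a)" "Suc c" "Suc a" "Suc c"] unfolding R_iff by auto
  then have s_bot: "(a, c) \<in> bottom_labels ?U"
    using labelled_D[OF s'(2)] s'(2) unfolding bottom_labels_iff by (auto simp: D_def)
  have spec: "special_box ?U = (a, c)"
  proof (rule special_box_eqI[OF _ s_bot])
    show "ferrers (shape ?U)" using fD by simp
    fix b assume b: "b \<in> bottom_labels ?U"
    obtain i j where ij: "b = (i, j)" by force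
    have b': "(i, j) \<in> D" "(Suc i, j) \<notin> D" "box_label T (i, j) \<noteq> None"
      using b unfolding ij bottom_labels_iff by auto
    show "snd b \<le> snd (a, c)"
    proof (rule ccontr)
      assume "\<not> snd b \<le> snd (a, c)"
      then have c: "c < j" using ij by simp
      have "(Suc a, c) \<notin> D" using \<open>(Suc a, c) \<in> R\<close> unfolding D_def by simp
      then have "i \<le> a" using bottom_order[OF fD b'(1), of a c] c by simp
      moreover have "(Suc i, j) \<in> R" using no_bottom[OF b'(3)] b'(2) c s'(5) unfolding D_def by simp
      ultimately show False using c unfolding R_iff by auto
    qed
  qed
  have "(r, Suc k) \<in> R"
    using start \<open>a < r\<close> s'(5) p' down[of "Suc r" "Suc (Suc k)" "Suc r" k] unfolding R_iff by auto
  then have corner: "labelled_corner ?U (r, k)"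
    using labelled_D[OF p'(3)] p' unfolding labelled_corner_def bottom_labels_iff by (auto simp: D_def)
  have "ribbon_shape D r c = shape T"
  proof (intro set_eqI iffI)
    fix x assume x: "x \<in> ribbon_shape D r c"
    show "x \<in> shape T"
    proof (cases "x \<in> D")
      case True
      then show ?thesis unfolding D_def by simp
    next
      case False
      then obtain i j where ij: "x = (Suc i, Suc j)" "(i, j) \<in> D" "i < r" "j < c"
        using x unfolding ribbon_shape_def by blast
      show ?thesis
      proof (rule ccontr)
        assume nT: "x \<notin> shape T"
        show False
        proof (cases "k < j")
          case True
          then have "int c - int a \<le> int j - int i" using ij nT R_iff[of i j] unfolding D_def by auto
          then show False using down[OF s'(3), of "Suc i" "Suc j"] ij nT by simp
        next
          case False
          then show False using down[OF start, of "Suc i" "Suc j"] ij nT by simp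
        qed
      qed
    qed
  next
    fix x assume x: "x \<in> shape T"
    show "x \<in> ribbon_shape D r c"
    proof (cases "x \<in> R")
      case False
      then show ?thesis using x unfolding ribbon_shape_def D_def by simp
    next
      case True
      obtain i j where ij: "x = (i, j)" by force
      have R: "(Suc i, Suc j) \<notin> shape T" "k < j" "int j - int i < int c - int a" "0 < i"
        using True R_row unfolding ij R_iff by auto
      then obtain i' j' where ij': "i = Suc i'" "j = Suc j'" by (metis gr0_implies_Suc less_imp_Suc_add)
      have "(i', j') \<in> D" using down[OF x[unfolded ij], of i' j'] x ij ij' R_iff[of i' j'] unfolding D_def by auto
      moreover have "i' < r"
      proof (rule ccontr)
        assume "\<not> i' < r"
        then have "(Suc r, k) \<in> shape T" using down[of i j "Suc r" k] x ij ij' R(2) by simp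
        then show False using p' by simp
      qed
      moreover have "j' < c"
      proof (rule ccontr)
        assume "\<not> j' < c"
        then have "Suc c \<le> j" "Suc a \<le> i" using ij' R(3) by auto
        then have "(Suc a, Suc c) \<in> shape T" using down[of i j "Suc a" "Suc c"] x ij by simp
        then show False using s'(4) by simp
      qed
      ultimately show ?thesis unfolding ij ij' Suc_in_ribbon_shape by simp
    qed
  qed
  moreover have "(a, c) \<noteq> (r, k)" using s'(5) by simp
  ultimately have "close_ribbon (?U, (r, k)) = T"
    using close_ribbon_eq[OF U corner spec] by simp
  then show ?thesis using U corner by blast
qed

text \<open>
  If the root is special then the first column consists of the root only. So does the first row,
  since any other box in it would be labelled, as the only box of its column, and lie to the right
  of the root. This leaves two border edges.
\<close>
lemma special_box_neq_root:
  assumes T: "LTLT n T" and n: "2 \<le> n"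
  shows "special_box T \<noteq> (0, 0)"
proof
  assume s: "special_box T = (0, 0)"
  note f = LTLT_ferrers[OF T]
  have row: "(Suc 0, j) \<notin> shape T" for j
    using special_box_props(1)[OF T] ferrersD[OF f, of "Suc 0" j "Suc 0" 0] unfolding s bottom_labels_iff by auto
  have col: "(0, Suc j) \<notin> shape T" for j
  proof
    assume j: "(0, Suc j) \<in> shape T"
    obtain i where i: "box_label T (i, Suc j) \<noteq> None" using LTLT_col[OF T j] by blast
    have "i = 0" using LTLT_box[OF T i] ferrersD[OF f, of i "Suc j" "Suc 0" "Suc j"] row by (cases i) auto
    then have "(0, Suc j) \<in> bottom_labels T" using i j row unfolding bottom_labels_iff by simp
    then show False using special_box_props(2)[OF T, of "(0, Suc j)"] s by simp
  qed
  have "e \<in> {V 0, H 0}" if "edge_label T e \<noteq> None" for e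
  proof (cases e)
    case (V i)
    then have "(i, 0) \<in> shape T" using LTLT_filling(4)[OF T] that by simp
    then show ?thesis using V ferrersD[OF f, of i 0 "Suc 0" 0] row by (cases i) auto
  next
    case (H j)
    then have "(0, j) \<in> shape T" using LTLT_filling(5)[OF T] that by simp
    then show ?thesis using H col by (cases j) auto
  qed
  then have "dom (edge_label T) \<subseteq> {V 0, H 0}" by blast
  from card_mono[OF _ this] show False using LTLT_filling(2)[OF T] n by simp
qed

lemma bij_betw_close_ribbon:
  assumes "2 \<le> n"
  shows "bij_betw close_ribbon (marked_LTLTs n) {T. LTLT n T}"
  unfolding bij_betw_def
proof
  show "inj_on close_ribbon (marked_LTLTs n)"
    unfolding inj_on_def marked_LTLTs_def using close_ribbon_inj by fast
  have "LTLT n (close_ribbon (U, (r, k)))" if "LTLT n U" "labelled_corner U (r, k)" for U r k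
    using LTLT_close_ribbon[OF that, of "fst (special_box U)" "snd (special_box U)"] that
    by (cases "special_box U = (r, k)") (auto simp: close_ribbon_def)
  moreover have "T \<in> close_ribbon ` marked_LTLTs n" if T: "LTLT n T" for T
  proof -
    obtain r k where rk: "special_box T = (r, k)" by force
    obtain U where U: "LTLT n U" "labelled_corner U (r, k)" "close_ribbon (U, (r, k)) = T"
      using close_ribbon_surj[OF T rk] by blast
    then have "(U, (r, k)) \<in> marked_LTLTs n"
      using special_box_neq_root[OF T assms] rk unfolding marked_LTLTs_def by simp
    then show ?thesis using U(3) by blast
  qed
  ultimately show "close_ribbon ` marked_LTLTs n = {T. LTLT n T}"
    unfolding marked_LTLTs_def by auto
qed

section \<open>Adding and removing a column\<close>

lemma shift_simps:
  "shift k j \<noteq> k" "k \<noteq> shift k j" "shift k j = shift k j' \<longleftrightarrow> j = j'"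
  "shift k j \<le> shift k j' \<longleftrightarrow> j \<le> j'" "shift k j < shift k j' \<longleftrightarrow> j < j'"
  "shift k j \<le> k \<longleftrightarrow> j < k" "shift k j < k \<longleftrightarrow> j < k"
  "k \<le> shift k j \<longleftrightarrow> k \<le> j" "k < shift k j \<longleftrightarrow> k \<le> j"
  unfolding shift_def by auto

lemma shift_eq_0: "0 < k \<Longrightarrow> shift k j = 0 \<longleftrightarrow> j = 0"
  unfolding shift_def by auto

lemma shift_cases: obtains (new) "j = k" | (old) j' where "j = shift k j'"
proof (cases "j < k \<or> j = k")
  case True
  then show ?thesis using new old[of j] unfolding shift_def by auto
next
  case False
  then show ?thesis using old[of "j - 1"] unfolding shift_def by auto
qed

lemma column_addition_simps:
  fixes T r xy
  defines "U \<equiv> column_addition T r xy" and "k \<equiv> row_len (shape T) r"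
  shows "(i, shift k j) \<in> shape U \<longleftrightarrow> (i, j) \<in> shape T"
    and "(i, k) \<in> shape U \<longleftrightarrow> i \<le> r"
    and "box_label U (i, shift k j) = box_label T (i, j)"
    and "box_label U (i, k) = (if i = r then edge_label T (V r) else None)"
    and "edge_label U (V i) = (if i = r then Some (fst xy) else edge_label T (V i))"
    and "edge_label U (H (shift k j)) = edge_label T (H j)"
    and "edge_label U (H k) = Some (snd xy)"
  unfolding U_def column_addition_def k_def[symmetric] Let_def
  by (auto simp: shift_simps image_iff) (force simp: shift_def)+

lemma tableau_eqI:
  fixes T U :: tableau
  assumes "\<And>i j. (i, j) \<in> shape T \<longleftrightarrow> (i, j) \<in> shape U" "\<And>i j. box_label T (i, j) = box_label U (i, j)"
    "\<And>i. edge_label T (V i) = edge_label U (V i)" "\<And>j. edge_label T (H j) = edge_label U (H j)"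
  shows "T = U"
proof -
  have "shape T = shape U" using assms(1) by auto
  moreover have "box_label T = box_label U" using assms(2) by auto
  moreover have "edge_label T e = edge_label U e" for e using assms(3,4) by (cases e) auto
  ultimately show ?thesis by (simp add: tableau.equality ext)
qed

lemma column_addition_inj:
  assumes eq: "column_addition T r xy = column_addition T' r xy'"
    and k: "row_len (shape T) r = row_len (shape T') r"
  shows "T = T' \<and> xy = xy'"
proof
  note U = column_addition_simps[where T = T and r = r and xy = xy]
  note U' = column_addition_simps[where T = T' and r = r and xy = xy', folded eq k]
  show "xy = xy'" using U(5)[of r] U'(5)[of r] U(7) U'(7) by (simp add: prod_eq_iff)
  show "T = T'"
  proof (rule tableau_eqI)
    show "(i, j) \<in> shape T \<longleftrightarrow> (i, j) \<in> shape T'" for i j using U(1) U'(1) by metis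
    show "box_label T (i, j) = box_label T' (i, j)" for i j using U(3) U'(3) by metis
    show "edge_label T (V i) = edge_label T' (V i)" for i
      using U(4)[of r] U'(4)[of r] U(5)[of i] U'(5)[of i] by (cases "i = r") auto
    show "edge_label T (H j) = edge_label T' (H j)" for j using U(6) U'(6) by metis
  qed
qed

text \<open>
  The new line adds one border edge: the edges \<open>H j\<close> are renumbered around the new \<open>H k\<close>.
\<close>
lemma card_dom_shifted:
  fixes E F :: "edge \<Rightarrow> label option"
  assumes V: "\<And>i. F (V i) \<noteq> None \<longleftrightarrow> E (V i) \<noteq> None"
    and H: "\<And>j. F (H (shift k j)) \<noteq> None \<longleftrightarrow> E (H j) \<noteq> None" "F (H k) \<noteq> None"
    and fin: "finite (dom E) \<or> finite (dom F)"
  shows "card (dom F) = Suc (card (dom E))"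
proof -
  let ?f = "case_edge V (\<lambda>j. H (shift k j))"
  have inj: "inj_on ?f (dom E)" by (auto simp: inj_on_def shift_simps split: edge.splits)
  have "e \<in> dom F \<longleftrightarrow> e \<in> insert (H k) (?f ` dom E)" for e
  proof (cases e)
    case (V i)
    then show ?thesis using assms(1)[of i] by (force split: edge.splits)
  next
    case e: (H j)
    show ?thesis
    proof (cases j k rule: shift_cases)
      case new
      then show ?thesis using e H by auto
    next
      case (old j')
      then show ?thesis using e H(1)[of j'] by (force simp: shift_simps split: edge.splits)
    qed
  qed
  then have eq: "dom F = insert (H k) (?f ` dom E)" by blast
  then have "finite (dom E)" using fin finite_imageD[OF _ inj] by auto
  then show ?thesis unfolding eq using card_image[OF inj]
    by (subst card_insert_disjoint) (auto simp: shift_simps split: edge.splits)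
qed

lemma LTLT_row_label:
  assumes T: "LTLT n T" and r: "(r, 0) \<in> shape T"
  obtains l where "edge_label T (V r) = Some l" "r = 0 \<Longrightarrow> l = One" "r \<noteq> 0 \<Longrightarrow> l \<in> {Alpha, Gamma}"
proof -
  obtain l where l: "edge_label T (V r) = Some l" using LTLT_filling(4)[OF T, of r] r by auto
  show ?thesis
    using that[OF l] fillingD(3)[OF LTLT_filling(6)[OF T] l] fillingD(4)[OF LTLT_filling(6)[OF T] _ l] by blast
qed

text \<open>
  The new label has none above it, since the rest of its column is empty, and some label to its
  left, since its row already contained one. It does not disturb an old \<open>\<beta>\<close> or \<open>\<delta>\<close>,
  since nothing of its row lies to its right.
\<close>
lemma LTLT_column_addition:
  assumes T: "LTLT n T" and r: "(r, 0) \<in> shape T" and xy: "compatible (V r) xy"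
  shows "LTLT (Suc n) (column_addition T r xy)" (is "LTLT _ ?U")
proof -
  define k where "k = row_len (shape T) r"
  note f = LTLT_ferrers[OF T]
  note B = fillingD[OF LTLT_filling(6)[OF T]]
  note U = column_addition_simps[where T = T and r = r and xy = xy, folded k_def]
  have rk: "(r, j) \<in> shape T \<longleftrightarrow> j < k" for j unfolding k_def less_row_len_iff[OF f] by simp
  have k: "0 < k" using r rk by simp
  obtain l where l: "edge_label T (V r) = Some l" "r = 0 \<Longrightarrow> l = One" "r \<noteq> 0 \<Longrightarrow> l \<in> {Alpha, Gamma}"
    using LTLT_row_label[OF T r] by blast
  have Bk: "box_label ?U (i, k) \<noteq> None \<longleftrightarrow> i = r" for i using U(4) l by simp
  have BT: "box_label T (i, j) \<noteq> None \<Longrightarrow> (i, j) \<in> shape T" for i j by (rule LTLT_box[OF T])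
  have x: "fst xy = One \<longleftrightarrow> r = 0" "r \<noteq> 0 \<Longrightarrow> fst xy \<in> {Alpha, Gamma}" and y: "snd xy \<in> {Beta, Delta}"
    using xy by (cases xy; auto split: if_splits)+
  have ferr: "ferrers (shape ?U)" unfolding ferrers_def
  proof (intro conjI allI impI)
    have "{(i, k) |i. i \<le> r} \<subseteq> (\<lambda>i. (i, k)) ` {..r}" by auto
    then show "finite (shape ?U)"
      using f finite_subset unfolding column_addition_def k_def[symmetric] ferrers_def Let_def by auto
  next
    fix i j i' j' assume a: "(i, j) \<in> shape ?U \<and> i' \<le> i \<and> j' \<le> j"
    show "(i', j') \<in> shape ?U"
    proof (cases j k rule: shift_cases)
      case new
      then have i: "i \<le> r" using a U(2) by simp
      show ?thesis
      proof (cases j' k rule: shift_cases)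
        case new
        then show ?thesis using i a U(2) by simp
      next
        case (old j0)
        then have "(r, j0) \<in> shape T" using a new rk by (simp add: shift_simps)
        then show ?thesis using ferrersD[OF f, of r j0 i' j0] old i a U(1) by simp
      qed
    next
      case (old j1)
      then have j1: "(i, j1) \<in> shape T" using a U(1) by simp
      show ?thesis
      proof (cases j' k rule: shift_cases)
        case new
        then have "k \<le> j1" using a old by (simp add: shift_simps)
        then have "\<not> r \<le> i" using ferrersD[OF f j1, of r j1] rk[of j1] by auto
        then show ?thesis using new a U(2) by simp
      next
        case (old j0)
        then have "j0 \<le> j1" using a \<open>j = shift k j1\<close> by (simp add: shift_simps)
        then show ?thesis using ferrersD[OF f j1, of i' j0] old a U(1) by simp
      qed
    qed
  qed
  have "card (dom (edge_label ?U)) = Suc (card (dom (edge_label T)))"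
  proof (rule card_dom_shifted[where k = k])
    show "edge_label ?U (V i) \<noteq> None \<longleftrightarrow> edge_label T (V i) \<noteq> None" for i using U(5) l by simp
    show "finite (dom (edge_label T)) \<or> finite (dom (edge_label ?U))"
      using LTLT_filling(2)[OF T] by (metis card.infinite Suc_eq_plus1 nat.distinct(1))
  qed (simp_all add: U)
  then have card: "card (dom (edge_label ?U)) = Suc n + 1" using LTLT_filling(2)[OF T] by simp
  have sub: "b \<in> shape ?U" if "box_label ?U b \<noteq> None" for b
  proof -
    obtain i j where b: "b = (i, j)" by force
    show ?thesis using that U BT unfolding b by (cases j k rule: shift_cases) (auto split: if_splits)
  qed
  have s0: "shift k 0 = 0" using k unfolding shift_def by simp
  have Vdom: "edge_label ?U (V i) \<noteq> None \<longleftrightarrow> (i, 0) \<in> shape ?U" for i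
    using U(5)[of i] U(1)[of i 0] LTLT_filling(4)[OF T, of i] r s0 by simp
  have Hdom: "edge_label ?U (H j) \<noteq> None \<longleftrightarrow> (0, j) \<in> shape ?U" for j
    using U LTLT_filling(5)[OF T] by (cases j k rule: shift_cases) auto
  have "filling (box_label ?U) (edge_label ?U)"
    unfolding filling_def
  proof (intro conjI)
    show "box_label ?U (0, 0) = Some One" using U(3)[of 0 0] B(1) s0 by simp
    show "\<forall>i j l. box_label ?U (i, j) = Some l \<longrightarrow> (l = One \<longleftrightarrow> i = 0 \<or> j = 0)"
    proof (intro allI impI)
      fix i j l' assume a: "box_label ?U (i, j) = Some l'"
      show "l' = One \<longleftrightarrow> i = 0 \<or> j = 0"
        using a U B(2) l k by (cases j k rule: shift_cases) (auto simp: shift_eq_0 split: if_splits)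
    qed
    show "\<forall>e l. edge_label ?U e = Some l \<longrightarrow> (l = One \<longleftrightarrow> e = V 0 \<or> e = H 0)"
    proof (intro allI impI)
      fix e l' assume a: "edge_label ?U e = Some l'"
      show "l' = One \<longleftrightarrow> e = V 0 \<or> e = H 0"
      proof (cases e)
        case (V i)
        then show ?thesis using a U(5)[of i] B(3)[of "V i" l'] x by (auto split: if_splits)
      next
        case (H j)
        then show ?thesis using a U B(3)[of "H _" l'] y k
          by (cases j k rule: shift_cases) (auto simp: shift_eq_0 split: if_splits)
      qed
    qed
    show "\<forall>r l. r \<noteq> 0 \<and> edge_label ?U (V r) = Some l \<longrightarrow> l \<in> {Alpha, Gamma}"
      using U(5) B(4) x by (auto split: if_splits)
    show "\<forall>c l. c \<noteq> 0 \<and> edge_label ?U (H c) = Some l \<longrightarrow> l \<in> {Beta, Delta}"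
    proof (intro allI impI)
      fix c l' assume a: "c \<noteq> 0 \<and> edge_label ?U (H c) = Some l'"
      show "l' \<in> {Beta, Delta}"
      proof (cases c k rule: shift_cases)
        case new
        then show ?thesis using a U(7) y by simp
      next
        case (old j)
        then show ?thesis using a U(6)[of j] B(5)[of j l'] s0 by (cases "j = 0") auto
      qed
    qed
    show "\<forall>i. edge_label ?U (V i) \<noteq> None \<longrightarrow> (\<exists>j. box_label ?U (i, j) \<noteq> None)"
    proof (intro allI impI)
      fix i assume "edge_label ?U (V i) \<noteq> None"
      then show "\<exists>j. box_label ?U (i, j) \<noteq> None"
        using U(5)[of i] B(6)[of i] U(3)[of i] Bk[of i] by (metis)
    qed
    show "\<forall>j. edge_label ?U (H j) \<noteq> None \<longrightarrow> (\<exists>i. box_label ?U (i, j) \<noteq> None)"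
    proof (intro allI impI)
      fix j assume "edge_label ?U (H j) \<noteq> None"
      then show "\<exists>i. box_label ?U (i, j) \<noteq> None"
        by (cases j k rule: shift_cases) (use Bk U(6) U(3) B(7) in \<open>metis+\<close>)
    qed
    show "\<forall>i j. box_label ?U (i, j) \<in> {Some Alpha, Some Gamma} \<longrightarrow>
        (\<forall>i'<i. box_label ?U (i', j) = None) \<and> (\<exists>j'<j. box_label ?U (i, j') \<noteq> None)"
    proof (intro allI impI)
      fix i j assume a: "box_label ?U (i, j) \<in> {Some Alpha, Some Gamma}"
      show "(\<forall>i'<i. box_label ?U (i', j) = None) \<and> (\<exists>j'<j. box_label ?U (i, j') \<noteq> None)"
      proof (cases j k rule: shift_cases)
        case new
        then have i: "i = r" using a Bk[of i] by auto
        have "\<exists>j. box_label T (r, j) \<noteq> None" using LTLT_row[OF T r] .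
        then obtain j0 where "box_label T (r, j0) \<noteq> None" by blast
        then have "box_label ?U (r, shift k j0) \<noteq> None" "shift k j0 < k"
          using U(3)[of r j0] BT[of r j0] rk by (auto simp: shift_simps)
        moreover have "\<forall>i'<i. box_label ?U (i', k) = None" using Bk i by (metis less_irrefl)
        ultimately show ?thesis unfolding i new by blast
      next
        case (old j0)
        then have a': "box_label T (i, j0) \<in> {Some Alpha, Some Gamma}" using a U(3) by simp
        obtain j1 where "j1 < j0" "box_label T (i, j1) \<noteq> None" using B(9)[OF a'] by blast
        then have "shift k j1 < j" "box_label ?U (i, shift k j1) \<noteq> None"
          using old U(3) by (auto simp: shift_simps)
        then show ?thesis using B(8)[OF a'] old U(3) by auto
      qed
    qed
    show "\<forall>i j. box_label ?U (i, j) \<in> {Some Beta, Some Delta} \<longrightarrow>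
        (\<forall>j'<j. box_label ?U (i, j') = None) \<and> (\<exists>i'<i. box_label ?U (i', j) \<noteq> None)"
    proof (intro allI impI)
      fix i j assume a: "box_label ?U (i, j) \<in> {Some Beta, Some Delta}"
      show "(\<forall>j'<j. box_label ?U (i, j') = None) \<and> (\<exists>i'<i. box_label ?U (i', j) \<noteq> None)"
      proof (cases j k rule: shift_cases)
        case new
        then show ?thesis using a U(4) l by (cases "r = 0") (auto split: if_splits)
      next
        case (old j0)
        then have a': "box_label T (i, j0) \<in> {Some Beta, Some Delta}" using a U(3) by simp
        have "box_label ?U (i, j') = None" if "j' < j" for j'
        proof (cases j' k rule: shift_cases)
          case new
          then have "k \<le> j0" using that old by (simp add: shift_simps)
          then have "i \<noteq> r" using BT[of i j0] a' rk[of j0] by auto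
          then show ?thesis using Bk new by blast
        next
          case j1: (old j1)
          then show ?thesis using B(10)[OF a', of j1] U(3) that old by (simp add: shift_simps)
        qed
        then show ?thesis using B(11)[OF a'] U(3) old by auto
      qed
    qed
  qed
  then show ?thesis unfolding LTLT_iff_filling using ferr card sub Vdom Hdom by blast
qed

lemma column_addition_corner:
  assumes T: "LTLT n T" and r: "(r, 0) \<in> shape T"
  shows "labelled_corner (column_addition T r xy) (r, row_len (shape T) r)"
    and "0 < row_len (shape T) r"
    and "box_label (column_addition T r xy) (r, row_len (shape T) r) = edge_label T (V r)"
proof -
  define k where "k = row_len (shape T) r"
  note f = LTLT_ferrers[OF T]
  note U = column_addition_simps[where T = T and r = r and xy = xy, folded k_def]
  have rk: "(r, j) \<in> shape T \<longleftrightarrow> j < k" for j unfolding k_def less_row_len_iff[OF f] by simp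
  show "0 < row_len (shape T) r" using rk r unfolding k_def by simp
  show "box_label (column_addition T r xy) (r, row_len (shape T) r) = edge_label T (V r)"
    using U(4) unfolding k_def by simp
  have "shift k k = Suc k" unfolding shift_def by simp
  then have "(r, Suc k) \<notin> shape (column_addition T r xy)" using U(1)[of r k] rk by simp
  moreover have "edge_label T (V r) \<noteq> None" using LTLT_row_label[OF T r] by blast
  ultimately show "labelled_corner (column_addition T r xy) (r, row_len (shape T) r)"
    unfolding labelled_corner_def bottom_labels_iff k_def[symmetric] using U(2,4) by simp
qed

text \<open>
  Inverse of the column addition. The assumption on the label ensures that \<open>(r, k)\<close> carries the only
  label of its column, so that no other label is lost; and the row of this label keeps another one,
  which for \<open>r = 0\<close> is the root.
\<close>
lemma column_removal:
  assumes U: "LTLT (Suc n) U" and p: "labelled_corner U (r, k)" and k: "0 < k"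
    and lab: "r = 0 \<or> box_label U (r, k) \<in> {Some Alpha, Some Gamma}"
  shows "\<exists>T xy. LTLT n T \<and> (r, 0) \<in> shape T \<and> compatible (V r) xy \<and>
           row_len (shape T) r = k \<and> column_addition T r xy = U"
proof -
  note f = LTLT_ferrers[OF U]
  note B = fillingD[OF LTLT_filling(6)[OF U]]
  have p': "(r, k) \<in> shape U" "(Suc r, k) \<notin> shape U" "(r, Suc k) \<notin> shape U" "box_label U (r, k) \<noteq> None"
    using p unfolding labelled_corner_def bottom_labels_iff by auto
  have col: "(i, k) \<in> shape U \<longleftrightarrow> i \<le> r" for i
    using p' ferrersD[OF f, of i k "Suc r" k] ferrersD[OF f p'(1), of i k] by (cases "i \<le> r") auto
  have row: "(r, j) \<in> shape U \<longleftrightarrow> j \<le> k" for j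
    using p' ferrersD[OF f, of r j r "Suc k"] ferrersD[OF f p'(1), of r j] by (cases "j \<le> k") auto
  have Bk: "box_label U (i, k) = None" if "i \<noteq> r" for i
  proof (cases "i < r")
    case True
    then show ?thesis using B(8)[of r k i] lab by auto
  next
    case False
    then show ?thesis using LTLT_box[OF U, of "(i, k)"] col that by fastforce
  qed
  define T where "T = \<lparr>shape = {(i, j). (i, shift k j) \<in> shape U},
    box_label = (\<lambda>(i, j). box_label U (i, shift k j)),
    edge_label = (\<lambda>e. case e of V i \<Rightarrow> if i = r then box_label U (r, k) else edge_label U (V i)
                                | H j \<Rightarrow> edge_label U (H (shift k j)))\<rparr>"
  have T: "(i, j) \<in> shape T \<longleftrightarrow> (i, shift k j) \<in> shape U"
    "box_label T (i, j) = box_label U (i, shift k j)"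
    "edge_label T (V i) = (if i = r then box_label U (r, k) else edge_label U (V i))"
    "edge_label T (H j) = edge_label U (H (shift k j))" for i j
    unfolding T_def by auto
  have s0: "shift k 0 = 0" using k unfolding shift_def by simp
  have fT: "ferrers (shape T)" unfolding ferrers_def
  proof (intro conjI allI impI)
    have "shape T = (\<lambda>(i, j). (i, shift k j)) -` shape U" unfolding T_def by auto
    moreover have "inj (\<lambda>(i :: nat, j). (i, shift k j))" by (auto simp: inj_on_def shift_simps)
    ultimately show "finite (shape T)" using f finite_vimageI unfolding ferrers_def by metis
  next
    fix i j i' j' assume "(i, j) \<in> shape T \<and> i' \<le> i \<and> j' \<le> j"
    then show "(i', j') \<in> shape T"
      unfolding T(1) using ferrersD[OF f, of i "shift k j" i' "shift k j'"] by (simp add: shift_simps)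
  qed
  have len: "row_len (shape T) r = k"
    by (rule row_len_eqI[OF fT]) (simp add: T(1) row shift_simps)
  have Vr: "edge_label U (V r) \<noteq> None" using LTLT_filling(4)[OF U, of r] row by simp
  have Hk: "edge_label U (H k) \<noteq> None" using LTLT_filling(5)[OF U, of k] col by simp
  obtain x y where x: "edge_label U (V r) = Some x" and y: "edge_label U (H k) = Some y"
    using Vr Hk by blast
  have comp: "compatible (V r) (x, y)"
    using B(3)[OF x] B(4)[OF _ x] B(3)[OF y] B(5)[OF _ y] k by simp
  have eq: "column_addition T r (x, y) = U"
  proof (rule tableau_eqI)
    note C = column_addition_simps[where T = T and r = r and xy = "(x, y)", unfolded len]
    fix i j
    show "(i, j) \<in> shape (column_addition T r (x, y)) \<longleftrightarrow> (i, j) \<in> shape U"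
      using C(1,2) T(1) col by (cases j k rule: shift_cases) auto
    show "box_label (column_addition T r (x, y)) (i, j) = box_label U (i, j)"
      using C(3,4) T(2,3) Bk by (cases j k rule: shift_cases) auto
    show "edge_label (column_addition T r (x, y)) (V i) = edge_label U (V i)"
      using C(5) T(3) x by simp
    show "edge_label (column_addition T r (x, y)) (H j) = edge_label U (H j)"
      using C(6,7) T(4) y by (cases j k rule: shift_cases) auto
  qed
  have "card (dom (edge_label U)) = Suc (card (dom (edge_label T)))"
  proof (rule card_dom_shifted[where k = k])
    show "edge_label U (V i) \<noteq> None \<longleftrightarrow> edge_label T (V i) \<noteq> None" for i using T(3) Vr p'(4) by simp
    show "finite (dom (edge_label T)) \<or> finite (dom (edge_label U))"
      using LTLT_filling(2)[OF U] by (metis card.infinite Suc_eq_plus1 nat.distinct(1))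
  qed (simp_all only: T Hk not_False_eq_True simp_thms)
  then have card: "card (dom (edge_label T)) = n + 1" using LTLT_filling(2)[OF U] by simp
  have sub: "b \<in> shape T" if "box_label T b \<noteq> None" for b
    using that LTLT_box[OF U] T by (cases b) auto
  have Vdom: "edge_label T (V i) \<noteq> None \<longleftrightarrow> (i, 0) \<in> shape T" for i
    using T(1)[of i 0] T(3)[of i] s0 LTLT_filling(4)[OF U, of i] row p'(4) by auto
  have Hdom: "edge_label T (H j) \<noteq> None \<longleftrightarrow> (0, j) \<in> shape T" for j
    using T(1)[of 0 j] T(4)[of j] LTLT_filling(5)[OF U] by simp
  have "filling (box_label T) (edge_label T)"
    unfolding filling_def
  proof (intro conjI)
    show "box_label T (0, 0) = Some One" using T(2) s0 B(1) by simp
    show "\<forall>i j l. box_label T (i, j) = Some l \<longrightarrow> (l = One \<longleftrightarrow> i = 0 \<or> j = 0)"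
      using T(2) B(2) shift_eq_0[OF k] by metis
    show "\<forall>e l. edge_label T e = Some l \<longrightarrow> (l = One \<longleftrightarrow> e = V 0 \<or> e = H 0)"
    proof (intro allI impI)
      fix e l assume a: "edge_label T e = Some l"
      show "l = One \<longleftrightarrow> e = V 0 \<or> e = H 0"
      proof (cases e)
        case (V i)
        then show ?thesis using a T(3)[of i] B(3)[of "V i" l] B(2)[of r k l] k by (auto split: if_splits)
      next
        case (H j)
        then show ?thesis using a T(4)[of j] B(3)[of "H (shift k j)" l] shift_eq_0[OF k] by auto
      qed
    qed
    show "\<forall>r l. r \<noteq> 0 \<and> edge_label T (V r) = Some l \<longrightarrow> l \<in> {Alpha, Gamma}"
    proof (intro allI impI)
      fix i l assume "i \<noteq> 0 \<and> edge_label T (V i) = Some l"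
      then show "l \<in> {Alpha, Gamma}" using T(3)[of i] B(4)[of i l] lab by (auto split: if_splits)
    qed
    show "\<forall>c l. c \<noteq> 0 \<and> edge_label T (H c) = Some l \<longrightarrow> l \<in> {Beta, Delta}"
      using T(4) B(5) shift_eq_0[OF k] by metis
    show "\<forall>i. edge_label T (V i) \<noteq> None \<longrightarrow> (\<exists>j. box_label T (i, j) \<noteq> None)"
    proof (intro allI impI)
      fix i assume a: "edge_label T (V i) \<noteq> None"
      obtain j where j: "box_label U (i, j) \<noteq> None" "j \<noteq> k"
      proof (cases "i = r")
        case True
        show ?thesis
        proof (cases "r = 0")
          case True
          then show ?thesis using that[of 0] \<open>i = r\<close> B(1) k by simp
        next
          case False
          then obtain j where "j < k" "box_label U (r, j) \<noteq> None" using B(9) lab by blast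
          then show ?thesis using that[of j] \<open>i = r\<close> by simp
        qed
      next
        case False
        then obtain j where "box_label U (i, j) \<noteq> None" using a T(3)[of i] B(6)[of i] by auto
        then show ?thesis using that[of j] Bk[OF False] by (cases "j = k") auto
      qed
      then obtain j' where "j = shift k j'" by (cases j k rule: shift_cases) auto
      then show "\<exists>j. box_label T (i, j) \<noteq> None" using T(2) j by auto
    qed
    show "\<forall>j. edge_label T (H j) \<noteq> None \<longrightarrow> (\<exists>i. box_label T (i, j) \<noteq> None)"
      using T(2,4) B(7) by metis
    show "\<forall>i j. box_label T (i, j) \<in> {Some Alpha, Some Gamma} \<longrightarrow>
        (\<forall>i'<i. box_label T (i', j) = None) \<and> (\<exists>j'<j. box_label T (i, j') \<noteq> None)"
    proof (intro allI impI)
      fix i j assume "box_label T (i, j) \<in> {Some Alpha, Some Gamma}"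
      then have a: "box_label U (i, shift k j) \<in> {Some Alpha, Some Gamma}" using T(2) by simp
      obtain j' where j': "j' < shift k j" "box_label U (i, j') \<noteq> None" using B(9)[OF a] by blast
      have "j' \<noteq> k"
      proof
        assume "j' = k"
        then have "i = r" using j'(2) Bk[of i] by metis
        then have "(r, shift k j) \<in> shape U" using a LTLT_box[OF U, of "(i, shift k j)"] by auto
        then show False using row j'(1) \<open>j' = k\<close> by simp
      qed
      then obtain j0 where "j' = shift k j0" by (cases j' k rule: shift_cases) auto
      then have "j0 < j" "box_label T (i, j0) \<noteq> None" using j' T(2) by (auto simp: shift_simps)
      then show "(\<forall>i'<i. box_label T (i', j) = None) \<and> (\<exists>j'<j. box_label T (i, j') \<noteq> None)"
        using B(8)[OF a] T(2) by auto
    qed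
    show "\<forall>i j. box_label T (i, j) \<in> {Some Beta, Some Delta} \<longrightarrow>
        (\<forall>j'<j. box_label T (i, j') = None) \<and> (\<exists>i'<i. box_label T (i', j) \<noteq> None)"
    proof (intro allI impI)
      fix i j assume "box_label T (i, j) \<in> {Some Beta, Some Delta}"
      then have a: "box_label U (i, shift k j) \<in> {Some Beta, Some Delta}" using T(2) by simp
      show "(\<forall>j'<j. box_label T (i, j') = None) \<and> (\<exists>i'<i. box_label T (i', j) \<noteq> None)"
        using B(10)[OF a] B(11)[OF a] T(2) by (auto simp: shift_simps)
    qed
  qed
  then have "LTLT n T" unfolding LTLT_iff_filling using fT card sub Vdom Hdom by blast
  moreover have "(r, 0) \<in> shape T" using T(1) s0 row by simp
  ultimately show ?thesis using comp len eq by blast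
qed

section \<open>Reflection across the main diagonal\<close>

fun dual :: "label \<Rightarrow> label" where
  "dual One = One"
| "dual Alpha = Beta"
| "dual Beta = Alpha"
| "dual Gamma = Delta"
| "dual Delta = Gamma"

fun dual_edge :: "edge \<Rightarrow> edge" where
  "dual_edge (V i) = H i"
| "dual_edge (H j) = V j"

text \<open>
  Reflection across the main diagonal. It exchanges the conditions on \<open>\<alpha>\<close> and \<open>\<gamma>\<close> with
  those on \<open>\<beta>\<close> and \<open>\<delta>\<close>, so that it preserves labelled tree-like tableaux, and turns
  row additions into column additions.
\<close>
definition mirror :: "tableau \<Rightarrow> tableau" where
  "mirror T = \<lparr>shape = {(i, j). (j, i) \<in> shape T},
     box_label = (\<lambda>(i, j). map_option dual (box_label T (j, i))),
     edge_label = (\<lambda>e. map_option dual (edge_label T (dual_edge e)))\<rparr>"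

lemma dual_dual [simp]: "dual (dual l) = l" by (cases l) auto

lemma dual_dual_edge [simp]: "dual_edge (dual_edge e) = e" by (cases e) auto

lemma dual_eq_iff: "dual l = One \<longleftrightarrow> l = One" "dual l = Alpha \<longleftrightarrow> l = Beta" "dual l = Beta \<longleftrightarrow> l = Alpha"
  "dual l = Gamma \<longleftrightarrow> l = Delta" "dual l = Delta \<longleftrightarrow> l = Gamma"
  by (cases l; simp)+

lemma map_option_dual: "map_option dual u = Some l \<longleftrightarrow> u = Some (dual l)"
  by (cases u) auto

lemma mirror_simps:
  "(i, j) \<in> shape (mirror T) \<longleftrightarrow> (j, i) \<in> shape T"
  "box_label (mirror T) (i, j) = map_option dual (box_label T (j, i))"
  "edge_label (mirror T) e = map_option dual (edge_label T (dual_edge e))"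
  unfolding mirror_def by auto

lemma mirror_mirror [simp]: "mirror (mirror T) = T"
  by (rule tableau_eqI) (simp_all add: mirror_simps option.map_comp o_def option.map_ident)

lemma filling_mirror:
  assumes "filling (box_label T) (edge_label T)"
  shows "filling (box_label (mirror T)) (edge_label (mirror T))"
proof -
  note B = fillingD[OF assms]
  show ?thesis unfolding filling_def
  proof (intro conjI)
    show "\<forall>e l. edge_label (mirror T) e = Some l \<longrightarrow> (l = One \<longleftrightarrow> e = V 0 \<or> e = H 0)"
    proof (intro allI impI)
      fix e l assume "edge_label (mirror T) e = Some l"
      then show "l = One \<longleftrightarrow> e = V 0 \<or> e = H 0"
        using B(3)[of "dual_edge e" "dual l"]
        by (cases e) (auto simp: mirror_simps map_option_dual dual_eq_iff)
    qed
    show "\<forall>r l. r \<noteq> 0 \<and> edge_label (mirror T) (V r) = Some l \<longrightarrow> l \<in> {Alpha, Gamma}"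
    proof (intro allI impI)
      fix i l assume "i \<noteq> 0 \<and> edge_label (mirror T) (V i) = Some l"
      then show "l \<in> {Alpha, Gamma}"
        using B(5)[of i "dual l"] by (auto simp: mirror_simps map_option_dual dual_eq_iff)
    qed
    show "\<forall>c l. c \<noteq> 0 \<and> edge_label (mirror T) (H c) = Some l \<longrightarrow> l \<in> {Beta, Delta}"
    proof (intro allI impI)
      fix i l assume "i \<noteq> 0 \<and> edge_label (mirror T) (H i) = Some l"
      then show "l \<in> {Beta, Delta}"
        using B(4)[of i "dual l"] by (auto simp: mirror_simps map_option_dual dual_eq_iff)
    qed
    show "\<forall>i j l. box_label (mirror T) (i, j) = Some l \<longrightarrow> (l = One \<longleftrightarrow> i = 0 \<or> j = 0)"
    proof (intro allI impI)
      fix i j l assume "box_label (mirror T) (i, j) = Some l"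
      then show "l = One \<longleftrightarrow> i = 0 \<or> j = 0"
        using B(2)[of j i "dual l"] by (auto simp: mirror_simps map_option_dual dual_eq_iff)
    qed
    show "\<forall>i j. box_label (mirror T) (i, j) \<in> {Some Alpha, Some Gamma} \<longrightarrow>
        (\<forall>i'<i. box_label (mirror T) (i', j) = None) \<and> (\<exists>j'<j. box_label (mirror T) (i, j') \<noteq> None)"
    proof (intro allI impI)
      fix i j assume "box_label (mirror T) (i, j) \<in> {Some Alpha, Some Gamma}"
      then have a: "box_label T (j, i) \<in> {Some Beta, Some Delta}" by (auto simp: mirror_simps dual_eq_iff)
      show "(\<forall>i'<i. box_label (mirror T) (i', j) = None) \<and> (\<exists>j'<j. box_label (mirror T) (i, j') \<noteq> None)"
        using B(10)[OF a] B(11)[OF a] by (simp add: mirror_simps)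
    qed
    show "\<forall>i j. box_label (mirror T) (i, j) \<in> {Some Beta, Some Delta} \<longrightarrow>
        (\<forall>j'<j. box_label (mirror T) (i, j') = None) \<and> (\<exists>i'<i. box_label (mirror T) (i', j) \<noteq> None)"
    proof (intro allI impI)
      fix i j assume "box_label (mirror T) (i, j) \<in> {Some Beta, Some Delta}"
      then have a: "box_label T (j, i) \<in> {Some Alpha, Some Gamma}" by (auto simp: mirror_simps dual_eq_iff)
      show "(\<forall>j'<j. box_label (mirror T) (i, j') = None) \<and> (\<exists>i'<i. box_label (mirror T) (i', j) \<noteq> None)"
        using B(8)[OF a] B(9)[OF a] by (simp add: mirror_simps)
    qed
  qed (use B(1,6,7) in \<open>simp_all add: mirror_simps\<close>)
qed

lemma LTLT_mirror:
  assumes T: "LTLT n T"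
  shows "LTLT n (mirror T)"
  unfolding LTLT_iff_filling
proof (intro conjI allI)
  note f = LTLT_ferrers[OF T]
  have "shape (mirror T) = prod.swap ` shape T" unfolding mirror_def by force
  then show "ferrers (shape (mirror T))"
    using f unfolding ferrers_def mirror_simps by (metis finite_imageI)
  have "dom (edge_label (mirror T)) = dual_edge ` dom (edge_label T)"
    unfolding dom_def mirror_simps by (auto simp: image_iff) (metis dual_dual_edge)
  moreover have "inj dual_edge" by (rule injI) (metis dual_dual_edge)
  ultimately show "card (dom (edge_label (mirror T))) = n + 1"
    using LTLT_filling(2)[OF T] card_image[of dual_edge] inj_on_subset by (metis subset_UNIV)
  show "filling (box_label (mirror T)) (edge_label (mirror T))"
    by (rule filling_mirror[OF LTLT_filling(6)[OF T]])
  show "box_label (mirror T) b \<noteq> None \<longrightarrow> b \<in> shape (mirror T)" for b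
    using LTLT_box[OF T] by (cases b) (simp add: mirror_simps)
qed (use LTLT_filling(4,5)[OF T] in \<open>simp_all add: mirror_simps\<close>)

lemma labelled_corner_mirror:
  "labelled_corner (mirror T) (i, j) \<longleftrightarrow> labelled_corner T (j, i)"
  unfolding labelled_corner_def bottom_labels_iff by (auto simp: mirror_simps)

lemma row_len_mirror: "row_len (shape (mirror T)) c = col_len (shape T) c"
  unfolding row_len_def col_len_def mirror_simps ..

lemma row_addition_eq_mirror:
  "row_addition T c (x, y) = mirror (column_addition (mirror T) c (dual y, dual x))"
proof (rule tableau_eqI)
  define k where "k = col_len (shape T) c"
  note C = column_addition_simps[where T = "mirror T" and r = c and xy = "(dual y, dual x)",
      unfolded row_len_mirror, folded k_def]
  note R = row_addition_def[of T c "(x, y)", folded k_def, unfolded Let_def]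
  have sk: "shift k i - 1 = i" if "\<not> shift k i < k" for i using that unfolding shift_def by (auto split: if_splits)
  fix i j
  show "(i, j) \<in> shape (row_addition T c (x, y)) \<longleftrightarrow>
        (i, j) \<in> shape (mirror (column_addition (mirror T) c (dual y, dual x)))"
    using C(1,2)
    by (cases i k rule: shift_cases) (auto simp: mirror_simps R image_iff shift_simps Bex_def)
  show "box_label (row_addition T c (x, y)) (i, j) =
        box_label (mirror (column_addition (mirror T) c (dual y, dual x))) (i, j)"
    using C(3,4) sk
    by (cases i k rule: shift_cases) (auto simp: mirror_simps R shift_simps option.map_comp o_def option.map_ident, auto simp: shift_def)
  show "edge_label (row_addition T c (x, y)) (V i) =
        edge_label (mirror (column_addition (mirror T) c (dual y, dual x))) (V i)"
    using C(6,7) sk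
    by (cases i k rule: shift_cases) (auto simp: mirror_simps R shift_simps option.map_comp o_def option.map_ident, auto simp: shift_def)
  show "edge_label (row_addition T c (x, y)) (H j) =
        edge_label (mirror (column_addition (mirror T) c (dual y, dual x))) (H j)"
    using C(5) by (auto simp: mirror_simps R option.map_comp o_def option.map_ident)
qed

section \<open>Adding and removing a line\<close>

fun add_line :: "tableau \<Rightarrow> edge \<Rightarrow> label \<times> label \<Rightarrow> tableau \<times> box" where
  "add_line T (V r) xy = (column_addition T r xy, (r, row_len (shape T) r))"
| "add_line T (H c) xy = (row_addition T c xy, (col_len (shape T) c, c))"

definition dual_pair :: "label \<times> label \<Rightarrow> label \<times> label" where
  "dual_pair xy = (dual (snd xy), dual (fst xy))"

lemma dual_pair_dual_pair [simp]: "dual_pair (dual_pair xy) = xy"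
  unfolding dual_pair_def by simp

lemma compatible_dual: "compatible e xy \<Longrightarrow> compatible (dual_edge e) (dual_pair xy)"
  by (cases e; cases xy) (auto simp: dual_pair_def dual_eq_iff)

lemma add_line_H:
  "add_line T (H c) xy =
     map_prod mirror prod.swap (add_line (mirror T) (V c) (dual_pair xy))"
  by (cases xy) (simp add: row_addition_eq_mirror row_len_mirror dual_pair_def)

definition insertion_triples :: "nat \<Rightarrow> (tableau \<times> edge \<times> label \<times> label) set" where
  "insertion_triples n =
     {(T, e, xy). LTLT n T \<and> e \<in> border_edges (shape T) \<and> compatible e xy}"

lemma insertion_triples_V: "(T, V r, xy) \<in> insertion_triples n \<longleftrightarrow>
   LTLT n T \<and> (r, 0) \<in> shape T \<and> compatible (V r) xy"
  unfolding insertion_triples_def using V_in_border_edges[OF LTLT_ferrers] by auto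

lemma insertion_triples_H: "(T, H c, xy) \<in> insertion_triples n \<longleftrightarrow>
   LTLT n T \<and> (0, c) \<in> shape T \<and> compatible (H c) xy"
  unfolding insertion_triples_def using H_in_border_edges[OF LTLT_ferrers] by auto

lemma insertion_triples_dual:
  assumes "(T, e, xy) \<in> insertion_triples n"
  shows "(mirror T, dual_edge e, dual_pair xy) \<in> insertion_triples n"
proof (cases e)
  case (V r)
  then show ?thesis using assms LTLT_mirror compatible_dual[of e xy]
    unfolding V dual_edge.simps insertion_triples_V insertion_triples_H
    by (auto simp: mirror_simps)
next
  case (H c)
  then show ?thesis using assms LTLT_mirror compatible_dual[of e xy]
    unfolding H dual_edge.simps insertion_triples_V insertion_triples_H
    by (auto simp: mirror_simps)
qed

text \<open>
  Decides from the label and the position of the marked corner whether the corner stems from a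
  column addition. Label \<open>1\<close> is covered by its position: in the first row, away from the root,
  only a column can have been added.
\<close>
definition column_type :: "tableau \<times> box \<Rightarrow> bool" where
  "column_type = (\<lambda>(U, p). fst p = 0 \<or> box_label U p \<in> {Some Alpha, Some Gamma})"

lemma marked_LTLTs_mirror:
  "Up \<in> marked_LTLTs n \<Longrightarrow> map_prod mirror prod.swap Up \<in> marked_LTLTs n"
  unfolding marked_LTLTs_def using LTLT_mirror by (auto simp: labelled_corner_mirror)

lemma column_type_mirror:
  assumes "Up \<in> marked_LTLTs n"
  shows "column_type (map_prod mirror prod.swap Up) \<longleftrightarrow> \<not> column_type Up"
proof -
  obtain U r k where Up: "Up = (U, (r, k))" by (metis prod.collapse)
  have U: "LTLT n U" "labelled_corner U (r, k)" "(r, k) \<noteq> (0, 0)"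
    using assms unfolding Up marked_LTLTs_def by auto
  then obtain l where l: "box_label U (r, k) = Some l"
    unfolding labelled_corner_def bottom_labels_iff by auto
  have "l = One \<longleftrightarrow> r = 0 \<or> k = 0" by (rule fillingD(2)[OF LTLT_filling(6)[OF U(1)] l])
  then show ?thesis using U(3) l unfolding Up column_type_def
    by (cases l) (auto simp: mirror_simps)
qed

lemma add_line_V_marked:
  assumes "(T, V r, xy) \<in> insertion_triples n"
  shows "add_line T (V r) xy \<in> marked_LTLTs (Suc n)" "column_type (add_line T (V r) xy)"
proof -
  have T: "LTLT n T" and r: "(r, 0) \<in> shape T" and xy: "compatible (V r) xy"
    using assms unfolding insertion_triples_V by auto
  show "add_line T (V r) xy \<in> marked_LTLTs (Suc n)"
    using LTLT_column_addition[OF T r xy] column_addition_corner(1)[OF T r, of xy] column_addition_corner(2)[OF T r]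
    unfolding marked_LTLTs_def by simp
  show "column_type (add_line T (V r) xy)"
    using column_addition_corner(3)[OF T r, of xy] LTLT_row_label[OF T r]
    unfolding column_type_def by auto
qed

lemma add_line_H_marked:
  assumes "(T, H c, xy) \<in> insertion_triples n"
  shows "add_line T (H c) xy \<in> marked_LTLTs (Suc n)" "\<not> column_type (add_line T (H c) xy)"
  using add_line_V_marked[OF insertion_triples_dual[OF assms, unfolded dual_edge.simps]]
    marked_LTLTs_mirror column_type_mirror
  unfolding add_line_H by blast+

lemma add_line_V_inj:
  assumes "add_line T (V r) xy = add_line T' (V r') xy'"
  shows "T = T' \<and> r = r' \<and> xy = xy'"
proof -
  have r: "r' = r" and "row_len (shape T) r = row_len (shape T') r"
    and "column_addition T r xy = column_addition T' r xy'"
    using assms by auto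
  then show ?thesis using column_addition_inj[of T r xy T' xy'] by simp
qed

lemma map_prod_mirror_swap_inj:
  "map_prod mirror prod.swap a = map_prod mirror prod.swap b \<longleftrightarrow> a = b"
  by (cases a; cases b) (auto, metis mirror_mirror)

lemma add_line_H_inj:
  assumes "add_line T (H c) xy = add_line T' (H c') xy'"
  shows "T = T' \<and> c = c' \<and> xy = xy'"
proof -
  have "mirror T = mirror T' \<and> c = c' \<and> dual_pair xy = dual_pair xy'"
    by (rule add_line_V_inj) (use assms in \<open>simp only: add_line_H map_prod_mirror_swap_inj\<close>)
  then show ?thesis by (metis mirror_mirror dual_pair_dual_pair)
qed

lemma add_line_V_surj:
  assumes "Up \<in> marked_LTLTs (Suc n)" and "column_type Up"
  shows "\<exists>T r xy. (T, V r, xy) \<in> insertion_triples n \<and> add_line T (V r) xy = Up"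
proof -
  obtain U r k where Up: "Up = (U, (r, k))" by (metis prod.collapse)
  have U: "LTLT (Suc n) U" "labelled_corner U (r, k)" "(r, k) \<noteq> (0, 0)"
    and t: "r = 0 \<or> box_label U (r, k) \<in> {Some Alpha, Some Gamma}"
    using assms unfolding Up marked_LTLTs_def column_type_def by auto
  have "0 < k"
  proof (rule ccontr)
    assume "\<not> 0 < k"
    then show False using t U(3) fillingD(9)[OF LTLT_filling(6)[OF U(1)], of r k] by auto
  qed
  then show ?thesis
    using column_removal[OF U(1,2) _ t] unfolding Up insertion_triples_V add_line.simps by blast
qed

lemma add_line_H_surj:
  assumes "Up \<in> marked_LTLTs (Suc n)" and "\<not> column_type Up"
  shows "\<exists>T c xy. (T, H c, xy) \<in> insertion_triples n \<and> add_line T (H c) xy = Up"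
proof -
  let ?t = "map_prod mirror prod.swap"
  obtain T r xy where T: "(T, V r, xy) \<in> insertion_triples n" "add_line T (V r) xy = ?t Up"
    using add_line_V_surj marked_LTLTs_mirror[OF assms(1)] column_type_mirror[OF assms(1)] assms(2)
    by blast
  have "add_line (mirror T) (H r) (dual_pair xy) = ?t (?t Up)"
    unfolding add_line_H mirror_mirror dual_pair_dual_pair T(2) ..
  also have "\<dots> = Up" by (cases Up) simp
  finally show ?thesis using insertion_triples_dual[OF T(1), unfolded dual_edge.simps] by blast
qed

lemma bij_betw_add_line:
  "bij_betw (\<lambda>(T, e, xy). add_line T e xy) (insertion_triples n) (marked_LTLTs (Suc n))"
  unfolding bij_betw_def
proof
  show "inj_on (\<lambda>(T, e, xy). add_line T e xy) (insertion_triples n)"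
  proof (rule inj_onI)
    fix t t' assume t: "t \<in> insertion_triples n" "t' \<in> insertion_triples n"
      and eq': "(\<lambda>(T, e, xy). add_line T e xy) t = (\<lambda>(T, e, xy). add_line T e xy) t'"
    obtain T e xy T' e' xy' where tt: "t = (T, e, xy)" "t' = (T', e', xy')" by (metis prod.collapse)
    have a: "(T, e, xy) \<in> insertion_triples n" "(T', e', xy') \<in> insertion_triples n"
      and eq: "add_line T e xy = add_line T' e' xy'"
      using t eq' unfolding tt by simp_all
    have "T = T' \<and> e = e' \<and> xy = xy'"
    proof (cases e; cases e')
      fix r r' assume e: "e = V r" "e' = V r'"
      show ?thesis using add_line_V_inj[OF eq[unfolded e]] e by simp
    next
      fix c c' assume e: "e = H c" "e' = H c'"
      show ?thesis using add_line_H_inj[OF eq[unfolded e]] e by simp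
    next
      fix r c assume "e = V r" "e' = H c"
      then show ?thesis using add_line_V_marked(2) add_line_H_marked(2) a eq by metis
    next
      fix r c assume "e = H c" "e' = V r"
      then show ?thesis using add_line_V_marked(2) add_line_H_marked(2) a eq by metis
    qed
    then show "t = t'" unfolding tt by simp
  qed
  show "(\<lambda>(T, e, xy). add_line T e xy) ` insertion_triples n = marked_LTLTs (Suc n)"
  proof
    show "(\<lambda>(T, e, xy). add_line T e xy) ` insertion_triples n \<subseteq> marked_LTLTs (Suc n)"
    proof (rule image_subsetI)
      fix t assume t: "t \<in> insertion_triples n"
      obtain T e xy where "t = (T, e, xy)" by (metis prod.collapse)
      then show "(\<lambda>(T, e, xy). add_line T e xy) t \<in> marked_LTLTs (Suc n)"
        using t add_line_V_marked(1) add_line_H_marked(1)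
        by (cases e) (simp_all only: prod.case)
    qed
    show "marked_LTLTs (Suc n) \<subseteq> (\<lambda>(T, e, xy). add_line T e xy) ` insertion_triples n"
    proof
      fix Up assume "Up \<in> marked_LTLTs (Suc n)"
      then obtain T e xy where "(T, e, xy) \<in> insertion_triples n" "add_line T e xy = Up"
        using add_line_V_surj add_line_H_surj by metis
      then show "Up \<in> (\<lambda>(T, e, xy). add_line T e xy) ` insertion_triples n"
        by (auto simp: image_iff intro!: bexI[of _ "(T, e, xy)"])
    qed
  qed
qed

section \<open>The insertion procedure\<close>

text \<open>
  A column addition keeps the bottoms of all old columns and adds the bottom \<open>(r, k)\<close>. The new
  column comes to stand to the left of the special column \<open>c\<close> exactly if \<open>k \<le> c\<close>, which is
  also the condition for the edge to precede the special box.
\<close>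
lemma insertion_V_eq:
  assumes "(T, V r, xy) \<in> insertion_triples n"
  shows "insertion T (V r) xy = close_ribbon (add_line T (V r) xy)"
proof -
  have T: "LTLT n T" and r: "(r, 0) \<in> shape T" and xy: "compatible (V r) xy"
    using assms unfolding insertion_triples_V by auto
  define k where "k = row_len (shape T) r"
  let ?U = "column_addition T r xy"
  note f = LTLT_ferrers[OF T]
  note U = column_addition_simps[where T = T and r = r and xy = xy, folded k_def]
  have fU: "ferrers (shape ?U)" by (rule LTLT_ferrers[OF LTLT_column_addition[OF T r xy]])
  have rk: "(r, j) \<in> shape T \<longleftrightarrow> j < k" for j unfolding k_def less_row_len_iff[OF f] by simp
  have corner: "(r, k) \<in> bottom_labels ?U"
    using column_addition_corner(1)[OF T r, of xy] unfolding labelled_corner_def k_def by simp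
  have old: "(i, shift k j) \<in> bottom_labels ?U \<longleftrightarrow> (i, j) \<in> bottom_labels T" for i j
    unfolding bottom_labels_iff U ..
  have new: "i = r" if "(i, k) \<in> bottom_labels ?U" for i
    using that unfolding bottom_labels_iff U by auto
  obtain a c where s: "special_box T = (a, c)" by force
  have ac: "(a, c) \<in> bottom_labels T" and max: "\<And>i j. (i, j) \<in> bottom_labels T \<Longrightarrow> j \<le> c"
    using special_box_props[OF T] unfolding s by auto
  have prec: "precedes (shape T) (V r) (H c) \<longleftrightarrow> k \<le> c"
    unfolding precedes_def pos.simps k_def[symmetric]
  proof
    assume "k \<le> c"
    then have "col_len (shape T) c \<le> r" using rk[of c] less_col_len_iff[OF f, of r c] by auto
    then show "int k - int (Suc r) < int c - int (col_len (shape T) c)" using \<open>k \<le> c\<close> by simp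
  next
    assume *: "int k - int (Suc r) < int c - int (col_len (shape T) c)"
    show "k \<le> c"
    proof (rule ccontr)
      assume "\<not> k \<le> c"
      then have "r < col_len (shape T) c" using rk[of c] less_col_len_iff[OF f, of r c] by auto
      then show False using * \<open>\<not> k \<le> c\<close> by simp
    qed
  qed
  show ?thesis
  proof (cases "k \<le> c")
    case True
    have "special_box ?U = (a, shift k c)"
    proof (rule special_box_eqI[OF fU])
      show "(a, shift k c) \<in> bottom_labels ?U" using old ac by simp
      fix b assume b: "b \<in> bottom_labels ?U"
      obtain i j where ij: "b = (i, j)" by force
      show "snd b \<le> snd (a, shift k c)"
        using b old max True unfolding ij by (cases j k rule: shift_cases) (auto simp: shift_simps)
    qed
    then show ?thesis
      using prec True s unfolding close_ribbon_def by (simp add: Let_def k_def[symmetric] shift_simps)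
  next
    case False
    have "special_box ?U = (r, k)"
    proof (rule special_box_eqI[OF fU corner])
      fix b assume b: "b \<in> bottom_labels ?U"
      obtain i j where ij: "b = (i, j)" by force
      show "snd b \<le> snd (r, k)"
        using b old max[of i] False unfolding ij by (cases j k rule: shift_cases) (fastforce simp: shift_simps)+
    qed
    then show ?thesis
      using prec False s unfolding close_ribbon_def by (simp add: Let_def k_def[symmetric])
  qed
qed

text \<open>
  A row addition may change the bottom labels in the columns up to \<open>c0\<close>, but not further to the
  right. Hence the old special box remains special if it lies to the right of column \<open>c0\<close>, and gives way to
  the new labelled box otherwise.
\<close>
lemma insertion_H_eq:
  assumes "(T, H c0, xy) \<in> insertion_triples n"
  shows "insertion T (H c0) xy = close_ribbon (add_line T (H c0) xy)"
proof -
  have T: "LTLT n T" and c0: "(0, c0) \<in> shape T" and xy: "compatible (H c0) xy"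
    using assms unfolding insertion_triples_H by auto
  define k where "k = col_len (shape T) c0"
  let ?U = "row_addition T c0 xy"
  note f = LTLT_ferrers[OF T]
  have marked: "(?U, (k, c0)) \<in> marked_LTLTs (Suc n)"
    using add_line_H_marked(1)[OF assms] unfolding k_def by simp
  then have fU: "ferrers (shape ?U)" and corner: "(k, c0) \<in> bottom_labels ?U"
    unfolding marked_LTLTs_def labelled_corner_def using LTLT_ferrers by auto
  have ck: "(i, c0) \<in> shape T \<longleftrightarrow> i < k" for i unfolding k_def less_col_len_iff[OF f] by simp
  have short: "i < k" if "(i, j) \<in> shape T" "c0 \<le> j" for i j
    using ferrersD[OF f that(1), of i c0] that(2) ck by simp
  have sh: "(i, j) \<in> shape ?U \<longleftrightarrow> (i, j) \<in> shape T" if "c0 < j" for i j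
  proof
    assume "(i, j) \<in> shape ?U"
    then show "(i, j) \<in> shape T"
      using that short unfolding row_addition_def k_def[symmetric] Let_def
      by (fastforce simp: shift_def)
  next
    assume ij: "(i, j) \<in> shape T"
    then have "shift k i = i" using short that unfolding shift_def by simp
    then show "(i, j) \<in> shape ?U"
      using ij unfolding row_addition_def k_def[symmetric] Let_def by force
  qed
  have old: "(i, j) \<in> bottom_labels ?U \<longleftrightarrow> (i, j) \<in> bottom_labels T" if "c0 < j" for i j
  proof -
    have "box_label ?U (i, j) = box_label T (i, j)" if "(i, j) \<in> shape T"
      using short[OF that] \<open>c0 < j\<close> unfolding row_addition_def k_def[symmetric] Let_def by simp
    then show ?thesis using sh[OF that] unfolding bottom_labels_iff by metis
  qed
  obtain a c where s: "special_box T = (a, c)" by force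
  have ac: "(a, c) \<in> bottom_labels T" and max: "\<And>i j. (i, j) \<in> bottom_labels T \<Longrightarrow> j \<le> c"
    using special_box_props[OF T] unfolding s by auto
  have mono: "col_len (shape T) j' \<le> col_len (shape T) j" if "j \<le> j'" for j j'
    using less_col_len_iff[OF f] ferrersD[OF f _ order_refl that] by (metis less_irrefl not_less)
  have prec: "precedes (shape T) (H c0) (H c) \<longleftrightarrow> c0 < c"
    unfolding precedes_def pos.simps using mono[of c0 c] mono[of c c0] by (cases "c0 < c") auto
  show ?thesis
  proof (cases "c0 < c")
    case True
    have "special_box ?U = (a, c)"
    proof (rule special_box_eqI[OF fU])
      show "(a, c) \<in> bottom_labels ?U" using old[OF True] ac by simp
      fix b assume b: "b \<in> bottom_labels ?U"
      obtain i j where ij: "b = (i, j)" by force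
      show "snd b \<le> snd (a, c)"
        using b old[of j i] max[of i j] True unfolding ij by (cases "c0 < j") auto
    qed
    then show ?thesis
      using prec True s unfolding close_ribbon_def by (simp add: Let_def k_def[symmetric])
  next
    case False
    have "special_box ?U = (k, c0)"
    proof (rule special_box_eqI[OF fU corner])
      fix b assume b: "b \<in> bottom_labels ?U"
      obtain i j where ij: "b = (i, j)" by force
      show "snd b \<le> snd (k, c0)"
        using b old[of j i] max[of i j] False unfolding ij by (cases "c0 < j") auto
    qed
    then show ?thesis
      using prec False s unfolding close_ribbon_def by (simp add: Let_def k_def[symmetric])
  qed
qed

theorem proposition1p7:
  fixes n :: nat
  assumes "n \<ge> 1"
  shows "bij_betw (\<lambda>(T, e, xy). insertion T e xy)
           {(T, e, xy). LTLT n T \<and> e \<in> border_edges (shape T) \<and> compatible e xy}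
           {T'. LTLT (n + 1) T'}"
proof -
  have "bij_betw (close_ribbon \<circ> (\<lambda>(T, e, xy). add_line T e xy)) (insertion_triples n) {T. LTLT (Suc n) T}"
    using bij_betw_trans[OF bij_betw_add_line bij_betw_close_ribbon] assms by simp
  also have "?this \<longleftrightarrow> bij_betw (\<lambda>(T, e, xy). insertion T e xy) (insertion_triples n) {T. LTLT (Suc n) T}"
  proof (rule bij_betw_cong)
    fix t assume t: "t \<in> insertion_triples n"
    obtain T e xy where "t = (T, e, xy)" by (metis prod.collapse)
    then show "(close_ribbon \<circ> (\<lambda>(T, e, xy). add_line T e xy)) t = (\<lambda>(T, e, xy). insertion T e xy) t"
      using t insertion_V_eq insertion_H_eq by (cases e) (simp_all only: o_apply prod.case)
  qed
  finally show ?thesis unfolding insertion_triples_def by simp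
qed

end
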